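(* Let $\mathcal U:\ \mathcal U_1=X\rightleftarrows\cdots\rightleftarrows\mathcal U_n\rightleftarrows\mathcal U_{n+1}\rightleftarrows\cdots$ be the section/retraction chain of universal objects defined in the context, hosted as an ascending chain in $\mathrm{PR}\epsilon$. (i) Each single theory $\mathrm{PR}\epsilon_n$ admits coretractive embeddings $\sqsubset_A:A\to\mathcal U_n$, for each of its (pointed) objects $A$, into its universal object $\mathcal U_n$ within the chain $\mathcal U$. (ii) These coretractive embeddings also give canonical (coretractive) embeddings of all objects $A$ of $\mathrm{PR}\epsilon_n$ into later objects of the chain, i.e. with $\mathcal U_n$ replaced by $\mathcal U_m$, $m>n$, when the coretractive embedding $A\to\mathcal U_m$ is taken as the composite $$\sqsubset_A:\ A\xrightarrow{\sqsubset}\mathcal U_n\xrightarrow{\sqsubset}\cdots\xrightarrow{\sqsubset}\mathcal U_m .$$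
   Context: THEORIES. $\mathrm{PR}_a$ is the equational (categorical, free-variable) theory of primitive recursion: a Cartesian category freely generated by a terminal object $1$, binary products, an object $\mathbb N$ with $0:1\to\mathbb N$, $s:\mathbb N\to\mathbb N$, closed under iteration of endomaps ($f:A\to A$ gives $f^{\S}:A\times\mathbb N\to A$ with $f^\S(a,0)=a$, $f^\S(a,s\,n)=f(f^\S(a,n))$), with Freyd's uniqueness of the initialised iterated (if $h:A\times\mathbb N\to B$ satisfies $h(a,0)=f(a)$ and $h(a,s\,n)=g(h(a,n))$ then $h=g^\S\circ(f\times\mathbb N)$), and with abstraction: each predicate $\chi:A\to 2$ has an extension $\{A\mid\chi\}\subset A$ as object; $2=\{n\in\mathbb N\mid n<2\}$. $\mathrm{PR}\epsilon$ is the extension of $\mathrm{PR}_a$ (same schemata for the larger class of objects) by formal exponential objects $B^A$ for all objects $A,B$, and map constants $\epsilon_{A,B}:B^A\times A\to B$ (closed evaluation) and $\lambda_{A,B}:A\to(A\times B)^B$, subject to the equations making conjugation $f:A\times B\to C\ \mapsto\ \overline f=f^B\circ\lambda_{A,B}:A\to C^B$ and coconjugation $g:A\to C^B\ \mapsto\ \overline g=\epsilon_{B,C}\circ(g\times\mathrm{id}_B):A\times B\to C$ mutually inverse, where $g^A=\overline{g\circ\epsilon_{A,B}}:B^A\to C^A$ for $g:B\to C$. So $(-)^B$ is right adjoint to $(-)\times B$ with unit $\lambda$ and counit $\epsilon$. For $g:B\to C$, $A^g:A^C\to A^B$ denotes the contravariant internal hom (precomposition). ORDER AND STRATA. $\mathrm{Ord}\,1=\mathrm{Ord}\,\mathbb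 N=1$; $\mathrm{Ord}(A\times B)=\max(\mathrm{Ord}\,A,\mathrm{Ord}\,B)$; $\mathrm{Ord}\{A\mid\chi\}=\mathrm{Ord}\,A$; $\mathrm{Ord}\,B^A=1+\mathrm{Ord}\,A$ for $B$ in $\mathrm{PR}_a$; $\mathrm{Ord}\,(C^B)^A=\mathrm{Ord}\,C^{B\times A}=1+\max(\mathrm{Ord}\,B,\mathrm{Ord}\,A)$ for $C$ in $\mathrm{PR}_a$. $\mathrm{PR}\epsilon_1=\mathrm{PR}_a$; $\mathrm{PR}\epsilon_{n+1}$ is the Cartesian-PR-category closure of $\mathrm{PR}\epsilon_n$ merged with: all objects of order $n+1$; the canonical isomorphisms $(C^B)^A\cong C^{B\times A}$ and their inverses for $C$ in $\mathrm{PR}_a$, $A,B$ in $\mathrm{PR}\epsilon_n$; the constants $\lambda_{A,B}$ with $\mathrm{Ord}\,A+\mathrm{Ord}\,B\le n+1$ and $2\,\mathrm{Ord}\,B\le n+1$, and $\epsilon_{A,B}$ with $\mathrm{Ord}\,A+\mathrm{Ord}\,B\le n+1$; with all instances of the conjugation/coconjugation equations whose ingredients are so available. So the objects of $\mathrm{PR}\epsilon_n$ are the objects of $\mathrm{PR}\epsilon$ of order at most $n$. CHAIN. A map is coretractive if it has a left inverse (a retraction); an object $A$ is pointed if it has a map $1\to A$. $X\subset\mathbb N$ is the $\mathrm{PR}_a$-object of codes $\langle n\rangle$ of singletons and (possibly nested) pairs $\langle a;b\rangle$ of natural numbers. Each $\mathrm{PR}_a$-object $A$ embeds canonically in $X$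 by $\sqsubset_A$ (numbers to singleton codes, pairs recursively to code pairs), with a canonical retraction $\sqsupset_A$ if $A$ is pointed. $\mathcal U_1=X$ and $\mathcal U_{n+1}=X^{\mathcal U_n}$. The chain maps are $\sqsubset:\mathcal U_n\to\mathcal U_{n+1}$ with retractions $\sqsupset:\mathcal U_{n+1}\to\mathcal U_n$: for $n=1$, $\sqsubset$ sends $x$ to the constant map with value $x$ (composite $X\cong X^1\xrightarrow{X^{!}}X^X$) and $\sqsupset$ is evaluation at $\langle 0\rangle$; for $n>1$, $\sqsubset\,=X^{(\sqsupset:\,\mathcal U_n\to\mathcal U_{n-1})}$ and $\sqsupset\,=X^{(\sqsubset:\,\mathcal U_{n-1}\to\mathcal U_n)}$.
   Formalization: Besides A being pointed, all exponents from which A is built are assumed pointed; otherwise the claim fails, e.g. for N^D with D neither pointed nor provably empty. Conjugation into C^B is taken as available in a stratum whenever ε_{B,C} is, and predicates of extensions lie in the stratum. *)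

theory Defs
  imports Main
begin

section \<open>Raw objects and maps\<close>

text \<open>\<open>Exp B A\<close> is the exponential \<open>B^A\<close>, and \<open>Sub A \<chi>\<close> is the extension \<open>{A | \<chi>}\<close>.\<close>

datatype obj =
    One
  | Nat
  | Prod obj obj
  | Sub obj mor
  | Exp obj obj
and mor =
    Id obj
  | Comp mor mor  (infixr "\<cdot>" 65)
  | Bang obj
  | Zero
  | Succ
  | Fst obj obj
  | Snd obj obj
  | Pair mor mor
  | Iter mor
  | Incl obj mor      \<comment> \<open>\<open>Incl A \<chi> : {A | \<chi>} \<rightarrow> A\<close>\<close>
  | Lift obj mor mor  \<comment> \<open>\<open>Lift A \<chi> f : C \<rightarrow> {A | \<chi>}\<close> is \<open>f : C \<rightarrow> A\<close> with restricted codomain\<close>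
  | Eps obj obj       \<comment> \<open>\<open>Eps A B : B^A \<times> A \<rightarrow> B\<close>\<close>
  | Lam obj obj       \<comment> \<open>\<open>Lam A B : A \<rightarrow> (A \<times> B)^B\<close>\<close>
  | Conj mor          \<comment> \<open>conjugation: \<open>A \<times> B \<rightarrow> C\<close> to \<open>A \<rightarrow> C^B\<close>\<close>
  | IsoTo obj obj obj    \<comment> \<open>\<open>IsoTo A B C : (C^B)^A \<rightarrow> C^(B \<times> A)\<close>\<close>
  | IsoFrom obj obj obj  \<comment> \<open>\<open>IsoFrom A B C : C^(B \<times> A) \<rightarrow> (C^B)^A\<close>\<close>

text \<open>\<open>f \<times> g\<close> for maps \<open>f\<close>, \<open>g\<close> with domains \<open>A\<close>, \<open>B\<close>.\<close>

definition cross :: "obj \<Rightarrow> obj \<Rightarrow> mor \<Rightarrow> mor \<Rightarrow> mor" where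
  "cross A B f g = Pair (f \<cdot> Fst A B) (g \<cdot> Snd A B)"

definition zero_of :: "obj \<Rightarrow> mor" where
  "zero_of A = Zero \<cdot> Bang A"

definition true_of :: "obj \<Rightarrow> mor" where
  "true_of A = Succ \<cdot> Zero \<cdot> Bang A"

text \<open>Predecessor: second component of the iteration of \<open>(m, p) \<mapsto> (m + 1, m)\<close> on \<open>(0, 0)\<close>.\<close>

definition pred_map :: mor where
  "pred_map =
     Snd Nat Nat \<cdot> Iter (Pair (Succ \<cdot> Fst Nat Nat) (Fst Nat Nat))
       \<cdot> Pair (Pair (zero_of Nat) (zero_of Nat)) (Id Nat)"

text \<open>Negation, \<open>0 \<mapsto> 1\<close> and \<open>n + 1 \<mapsto> 0\<close>: the constant \<open>0\<close> iterated on \<open>1\<close>.\<close>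

definition not_map :: mor where
  "not_map = Iter (zero_of Nat) \<cdot> Pair (true_of Nat) (Id Nat)"

text \<open>The characteristic map of \<open>n < 2\<close>, that is, of \<open>n - 1 = 0\<close> for truncated subtraction.\<close>

definition less_two :: mor where
  "less_two = not_map \<cdot> pred_map"

text \<open>The functorial \<open>g^A = conj (g \<circ> \<epsilon>) : B^A \<rightarrow> C^A\<close> for \<open>g : B \<rightarrow> C\<close>.\<close>

definition pow_map :: "obj \<Rightarrow> obj \<Rightarrow> mor \<Rightarrow> mor" where
  "pow_map A B g = Conj (g \<cdot> Eps A B)"

text \<open>\<open>coconj A B C g : A \<times> B \<rightarrow> C\<close> for \<open>g : A \<rightarrow> C^B\<close>.\<close>

definition coconj :: "obj \<Rightarrow> obj \<Rightarrow> obj \<Rightarrow> mor \<Rightarrow> mor" where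
  "coconj A B C g = Eps B C \<cdot> cross A B g (Id B)"

text \<open>Precomposition \<open>A^g : A^C \<rightarrow> A^B\<close> for \<open>g : B \<rightarrow> C\<close>.\<close>

definition precomp :: "obj \<Rightarrow> obj \<Rightarrow> obj \<Rightarrow> mor \<Rightarrow> mor" where
  "precomp A B C g = Conj (Eps C A \<cdot> cross (Exp A C) B (Id (Exp A C)) g)"

text \<open>The canonical \<open>(C^B)^A \<rightarrow> C^(B \<times> A)\<close>, \<open>F \<mapsto> ((b, a) \<mapsto> F a b)\<close>.\<close>

definition canonical_iso :: "obj \<Rightarrow> obj \<Rightarrow> obj \<Rightarrow> mor" where
  "canonical_iso A B C =
     (let E = Exp (Exp C B) A; P = Prod B A in
      Conj (Eps B C \<cdot>
        Pair (Eps A (Exp C B) \<cdot> Pair (Fst E P) (Snd B A \<cdot> Snd E P))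
             (Fst B A \<cdot> Snd E P)))"


section \<open>Theories\<close>

text \<open>
  All the theories considered share their schemata and differ only in the exponentials and
  constants available: \<open>has_exp B A\<close> for \<open>B^A\<close>, \<open>has_eps A B\<close> for \<open>\<epsilon>\<close>, \<open>has_lam A B\<close> for
  \<open>\<lambda>\<close>, and \<open>has_iso A B C\<close> for the isomorphisms between \<open>(C^B)^A\<close> and \<open>C^(B \<times> A)\<close>.
\<close>

datatype thy = Thy
  (has_exp: "obj \<Rightarrow> obj \<Rightarrow> bool")
  (has_eps: "obj \<Rightarrow> obj \<Rightarrow> bool")
  (has_lam: "obj \<Rightarrow> obj \<Rightarrow> bool")
  (has_iso: "obj \<Rightarrow> obj \<Rightarrow> obj \<Rightarrow> bool")

text \<open>
  \<open>Obj T A\<close>: \<open>A\<close> is an object of \<open>T\<close>; \<open>Map T A B f\<close>: \<open>f : A \<rightarrow> B\<close> is a map of \<open>T\<close>;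
  \<open>Eqn T A B f g\<close>: \<open>T\<close> derives \<open>f = g : A \<rightarrow> B\<close>.

  A predicate \<open>A \<rightarrow> 2\<close>, where \<open>2 = {n | n < 2}\<close>, is rendered as a map \<open>\<chi> : A \<rightarrow> \<nat>\<close> with
  \<open>(\<chi> a < 2) = true\<close>. This is what a map into the extension \<open>2\<close> amounts to, and it avoids
  the circularity of \<open>2\<close> being the extension of a predicate with values in \<open>2\<close>.

  Conjugation is a primitive operation, since the equations \<open>conj f = f^B \<circ> \<lambda>\<close> and
  \<open>g^A = conj (g \<circ> \<epsilon>)\<close> refer to each other. The first of them is the rule \<open>conj_lam\<close>,
  the second the definition of \<open>pow_map\<close>. Conjugation to \<open>C^B\<close> is available as soon as the
  constant \<open>\<epsilon>\<close> occurring in the (co)conjugation equations for \<open>C^B\<close> is. It cannot be tied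
  to the availability of \<open>\<lambda>\<^sub>A\<^sub>B\<close>: the ingredient \<open>f^B\<close> of \<open>f^B \<circ> \<lambda>\<^sub>A\<^sub>B\<close> is itself
  a conjugate, of a map on \<open>(A \<times> B)^B \<times> B\<close>.
\<close>

inductive Obj :: "thy \<Rightarrow> obj \<Rightarrow> bool"
  and Map :: "thy \<Rightarrow> obj \<Rightarrow> obj \<Rightarrow> mor \<Rightarrow> bool"
  and Eqn :: "thy \<Rightarrow> obj \<Rightarrow> obj \<Rightarrow> mor \<Rightarrow> mor \<Rightarrow> bool"
  for T :: thy
where
  obj_One: "Obj T One"
| obj_Nat: "Obj T Nat"
| obj_Prod: "Obj T A \<Longrightarrow> Obj T B \<Longrightarrow> Obj T (Prod A B)"
| obj_Sub: "Map T A Nat \<chi> \<Longrightarrow> Eqn T A Nat (less_two \<cdot> \<chi>) (true_of A) \<Longrightarrow> Obj T (Sub A \<chi>)"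
| obj_Exp: "Obj T A \<Longrightarrow> Obj T B \<Longrightarrow> has_exp T B A \<Longrightarrow> Obj T (Exp B A)"

| map_Id: "Obj T A \<Longrightarrow> Map T A A (Id A)"
| map_Comp: "Map T A B f \<Longrightarrow> Map T B C g \<Longrightarrow> Map T A C (g \<cdot> f)"
| map_Bang: "Obj T A \<Longrightarrow> Map T A One (Bang A)"
| map_Zero: "Map T One Nat Zero"
| map_Succ: "Map T Nat Nat Succ"
| map_Fst: "Obj T A \<Longrightarrow> Obj T B \<Longrightarrow> Map T (Prod A B) A (Fst A B)"
| map_Snd: "Obj T A \<Longrightarrow> Obj T B \<Longrightarrow> Map T (Prod A B) B (Snd A B)"
| map_Pair: "Map T C A f \<Longrightarrow> Map T C B g \<Longrightarrow> Map T C (Prod A B) (Pair f g)"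
| map_Iter: "Map T A A f \<Longrightarrow> Map T (Prod A Nat) A (Iter f)"
| map_Incl: "Obj T A \<Longrightarrow> Obj T (Sub A \<chi>) \<Longrightarrow> Map T (Sub A \<chi>) A (Incl A \<chi>)"
| map_Lift: "Obj T (Sub A \<chi>) \<Longrightarrow> Map T C A f \<Longrightarrow> Eqn T C Nat (\<chi> \<cdot> f) (true_of C)
    \<Longrightarrow> Map T C (Sub A \<chi>) (Lift A \<chi> f)"
| map_Eps: "Obj T A \<Longrightarrow> Obj T B \<Longrightarrow> Obj T (Exp B A) \<Longrightarrow> has_eps T A B
    \<Longrightarrow> Map T (Prod (Exp B A) A) B (Eps A B)"
| map_Lam: "Obj T A \<Longrightarrow> Obj T B \<Longrightarrow> Obj T (Exp (Prod A B) B) \<Longrightarrow> has_lam T A B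
    \<Longrightarrow> Map T A (Exp (Prod A B) B) (Lam A B)"
| map_Conj: "Obj T A \<Longrightarrow> Obj T B \<Longrightarrow> Obj T (Exp C B) \<Longrightarrow> has_eps T B C
    \<Longrightarrow> Map T (Prod A B) C f \<Longrightarrow> Map T A (Exp C B) (Conj f)"
| map_IsoTo: "Obj T (Exp (Exp C B) A) \<Longrightarrow> Obj T (Exp C (Prod B A)) \<Longrightarrow> has_iso T A B C
    \<Longrightarrow> Map T (Exp (Exp C B) A) (Exp C (Prod B A)) (IsoTo A B C)"
| map_IsoFrom: "Obj T (Exp (Exp C B) A) \<Longrightarrow> Obj T (Exp C (Prod B A)) \<Longrightarrow> has_iso T A B C
    \<Longrightarrow> Map T (Exp C (Prod B A)) (Exp (Exp C B) A) (IsoFrom A B C)"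

| eq_refl: "Map T A B f \<Longrightarrow> Eqn T A B f f"
| eq_sym: "Eqn T A B f g \<Longrightarrow> Eqn T A B g f"
| eq_trans: "Eqn T A B f g \<Longrightarrow> Eqn T A B g h \<Longrightarrow> Eqn T A B f h"
| eq_Comp: "Eqn T A B f f' \<Longrightarrow> Eqn T B C g g' \<Longrightarrow> Eqn T A C (g \<cdot> f) (g' \<cdot> f')"
| eq_Pair: "Eqn T C A f f' \<Longrightarrow> Eqn T C B g g' \<Longrightarrow> Eqn T C (Prod A B) (Pair f g) (Pair f' g')"
| eq_Iter: "Eqn T A A f f' \<Longrightarrow> Eqn T (Prod A Nat) A (Iter f) (Iter f')"
| eq_Lift: "Map T C (Sub A \<chi>) (Lift A \<chi> f) \<Longrightarrow> Map T C (Sub A \<chi>) (Lift A \<chi> f')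
    \<Longrightarrow> Eqn T C A f f' \<Longrightarrow> Eqn T C (Sub A \<chi>) (Lift A \<chi> f) (Lift A \<chi> f')"
| eq_Conj: "Map T A (Exp C B) (Conj f) \<Longrightarrow> Map T A (Exp C B) (Conj f')
    \<Longrightarrow> Eqn T (Prod A B) C f f' \<Longrightarrow> Eqn T A (Exp C B) (Conj f) (Conj f')"

| id_left: "Map T A B f \<Longrightarrow> Eqn T A B (Id B \<cdot> f) f"
| id_right: "Map T A B f \<Longrightarrow> Eqn T A B (f \<cdot> Id A) f"
| assoc: "Map T A B f \<Longrightarrow> Map T B C g \<Longrightarrow> Map T C D h
    \<Longrightarrow> Eqn T A D ((h \<cdot> g) \<cdot> f) (h \<cdot> (g \<cdot> f))"
| terminal: "Map T A One f \<Longrightarrow> Eqn T A One f (Bang A)"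
| fst_Pair: "Map T C A f \<Longrightarrow> Map T C B g \<Longrightarrow> Eqn T C A (Fst A B \<cdot> Pair f g) f"
| snd_Pair: "Map T C A f \<Longrightarrow> Map T C B g \<Longrightarrow> Eqn T C B (Snd A B \<cdot> Pair f g) g"
| surj_Pair: "Obj T A \<Longrightarrow> Obj T B \<Longrightarrow> Map T C (Prod A B) h
    \<Longrightarrow> Eqn T C (Prod A B) (Pair (Fst A B \<cdot> h) (Snd A B \<cdot> h)) h"

| iter_zero: "Map T A A f \<Longrightarrow> Obj T A \<Longrightarrow> Eqn T A A (Iter f \<cdot> Pair (Id A) (zero_of A)) (Id A)"
| iter_succ: "Map T A A f \<Longrightarrow> Obj T A
    \<Longrightarrow> Eqn T (Prod A Nat) A (Iter f \<cdot> cross A Nat (Id A) Succ) (f \<cdot> Iter f)"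
| freyd: "Obj T A \<Longrightarrow> Map T A B f \<Longrightarrow> Map T B B g \<Longrightarrow> Map T (Prod A Nat) B h
    \<Longrightarrow> Eqn T A B (h \<cdot> Pair (Id A) (zero_of A)) f
    \<Longrightarrow> Eqn T (Prod A Nat) B (h \<cdot> cross A Nat (Id A) Succ) (g \<cdot> h)
    \<Longrightarrow> Eqn T (Prod A Nat) B h (Iter g \<cdot> cross A Nat f (Id Nat))"

| incl_true: "Obj T A \<Longrightarrow> Obj T (Sub A \<chi>)
    \<Longrightarrow> Eqn T (Sub A \<chi>) Nat (\<chi> \<cdot> Incl A \<chi>) (true_of (Sub A \<chi>))"
| incl_Lift: "Map T C (Sub A \<chi>) (Lift A \<chi> f) \<Longrightarrow> Map T C A f
    \<Longrightarrow> Eqn T C A (Incl A \<chi> \<cdot> Lift A \<chi> f) f"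
| incl_mono: "Map T C (Sub A \<chi>) g \<Longrightarrow> Map T C (Sub A \<chi>) h
    \<Longrightarrow> Eqn T C A (Incl A \<chi> \<cdot> g) (Incl A \<chi> \<cdot> h) \<Longrightarrow> Eqn T C (Sub A \<chi>) g h"

| coconj_Conj: "Map T A (Exp C B) (Conj f) \<Longrightarrow> Map T (Prod A B) C f
    \<Longrightarrow> Map T (Prod (Exp C B) B) C (Eps B C)
    \<Longrightarrow> Eqn T (Prod A B) C (coconj A B C (Conj f)) f"
| Conj_coconj: "Map T A (Exp C B) g \<Longrightarrow> Map T (Prod (Exp C B) B) C (Eps B C)
    \<Longrightarrow> Map T A (Exp C B) (Conj (coconj A B C g))
    \<Longrightarrow> Eqn T A (Exp C B) (Conj (coconj A B C g)) g"
| conj_lam: "Map T A (Exp C B) (Conj f) \<Longrightarrow> Map T (Prod A B) C f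
    \<Longrightarrow> Map T A (Exp (Prod A B) B) (Lam A B)
    \<Longrightarrow> Map T (Exp (Prod A B) B) (Exp C B) (pow_map B (Prod A B) f)
    \<Longrightarrow> Eqn T A (Exp C B) (Conj f) (pow_map B (Prod A B) f \<cdot> Lam A B)"

| iso_to_from: "Map T (Exp (Exp C B) A) (Exp C (Prod B A)) (IsoTo A B C)
    \<Longrightarrow> Map T (Exp C (Prod B A)) (Exp (Exp C B) A) (IsoFrom A B C)
    \<Longrightarrow> Eqn T (Exp C (Prod B A)) (Exp C (Prod B A))
          (IsoTo A B C \<cdot> IsoFrom A B C) (Id (Exp C (Prod B A)))"
| iso_from_to: "Map T (Exp (Exp C B) A) (Exp C (Prod B A)) (IsoTo A B C)
    \<Longrightarrow> Map T (Exp C (Prod B A)) (Exp (Exp C B) A) (IsoFrom A B C)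
    \<Longrightarrow> Eqn T (Exp (Exp C B) A) (Exp (Exp C B) A)
          (IsoFrom A B C \<cdot> IsoTo A B C) (Id (Exp (Exp C B) A))"
| iso_canonical: "Map T (Exp (Exp C B) A) (Exp C (Prod B A)) (IsoTo A B C)
    \<Longrightarrow> Map T (Exp (Exp C B) A) (Exp C (Prod B A)) (canonical_iso A B C)
    \<Longrightarrow> Eqn T (Exp (Exp C B) A) (Exp C (Prod B A)) (IsoTo A B C) (canonical_iso A B C)"

definition PRa :: thy where
  "PRa = Thy (\<lambda>_ _. False) (\<lambda>_ _. False) (\<lambda>_ _. False) (\<lambda>_ _ _. False)"

text \<open>In \<open>PReps\<close> the isomorphism constants are definable: see \<open>iso_canonical\<close>.\<close>

definition PReps :: thy where
  "PReps = Thy (\<lambda>_ _. True) (\<lambda>_ _. True) (\<lambda>_ _. True) (\<lambda>_ _ _. True)"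

text \<open>
  \<open>has_order A n\<close>: the order of \<open>A\<close> is defined and equal to \<open>n\<close>. Exponentials are assigned an
  order only if their base is an object \<open>C\<close> of \<open>PRa\<close> or of the form \<open>C^B\<close> with such a \<open>C\<close>.
\<close>

inductive has_order :: "obj \<Rightarrow> nat \<Rightarrow> bool" where
  "has_order One 1"
| "has_order Nat 1"
| "has_order A m \<Longrightarrow> has_order B n \<Longrightarrow> has_order (Prod A B) (max m n)"
| "has_order A n \<Longrightarrow> has_order (Sub A \<chi>) n"
| "Obj PRa B \<Longrightarrow> has_order A n \<Longrightarrow> has_order (Exp B A) (1 + n)"
| "Obj PRa C \<Longrightarrow> has_order B m \<Longrightarrow> has_order A n
    \<Longrightarrow> has_order (Exp (Exp C B) A) (1 + max m n)"

text \<open>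
  The stratum with index \<open>n \<ge> 1\<close>. All orders being at least \<open>1\<close>, nothing is added to \<open>PRa\<close>
  for \<open>n = 1\<close>.
\<close>

definition PReps_stratum :: "nat \<Rightarrow> thy" where
  "PReps_stratum n = Thy
     (\<lambda>B A. \<exists>k. has_order (Exp B A) k \<and> k \<le> n)
     (\<lambda>A B. \<exists>i j. has_order A i \<and> has_order B j \<and> i + j \<le> n)
     (\<lambda>A B. \<exists>i j. has_order A i \<and> has_order B j \<and> i + j \<le> n \<and> 2 * j \<le> n)
     (\<lambda>A B C. Obj PRa C \<and> (\<exists>i j. has_order A i \<and> has_order B j \<and> i < n \<and> j < n))"


section \<open>Coretractions and points\<close>

definition retraction_pair :: "thy \<Rightarrow> obj \<Rightarrow> obj \<Rightarrow> mor \<Rightarrow> mor \<Rightarrow> bool" where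
  "retraction_pair T A B f g \<longleftrightarrow> Map T A B f \<and> Map T B A g \<and> Eqn T A A (g \<cdot> f) (Id A)"

definition coretractive :: "thy \<Rightarrow> obj \<Rightarrow> obj \<Rightarrow> mor \<Rightarrow> bool" where
  "coretractive T A B f \<longleftrightarrow> (\<exists>g. retraction_pair T A B f g)"

definition pointed :: "thy \<Rightarrow> obj \<Rightarrow> bool" where
  "pointed T A \<longleftrightarrow> (\<exists>p. Map T One A p)"

text \<open>
  The exponents from which an object is built are pointed as well. Without this, pointed objects
  such as \<open>\<nat>^(E^D)\<close>, for objects \<open>D\<close>, \<open>E\<close> that are neither pointed nor provably empty, need not
  be retracts of a member of the chain: the embedding of \<open>B^A\<close> is precomposition with a
  retraction onto \<open>A\<close>. (The bases are then pointed automatically.)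
\<close>

fun pointed_exponents :: "thy \<Rightarrow> obj \<Rightarrow> bool" where
  "pointed_exponents T One \<longleftrightarrow> True"
| "pointed_exponents T Nat \<longleftrightarrow> True"
| "pointed_exponents T (Prod A B) \<longleftrightarrow> pointed_exponents T A \<and> pointed_exponents T B"
| "pointed_exponents T (Sub A \<chi>) \<longleftrightarrow> pointed_exponents T A"
| "pointed_exponents T (Exp B A) \<longleftrightarrow>
     pointed T A \<and> pointed_exponents T A \<and> pointed_exponents T B"


section \<open>Codes\<close>

definition add_map :: mor where
  "add_map = Iter Succ"

text \<open>\<open>n \<mapsto> 0 + 1 + \<dots> + n\<close>, by iteration of \<open>(m, t) \<mapsto> (m + 1, t + (m + 1))\<close> on \<open>(0, 0)\<close>.\<close>

definition triangle_map :: mor where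
  "triangle_map =
     Snd Nat Nat
       \<cdot> Iter (Pair (Succ \<cdot> Fst Nat Nat)
                     (add_map \<cdot> Pair (Snd Nat Nat) (Succ \<cdot> Fst Nat Nat)))
       \<cdot> Pair (Pair (zero_of Nat) (zero_of Nat)) (Id Nat)"

text \<open>Cantor's bijection \<open>J(a, b) = (0 + \<dots> + (a + b)) + b\<close>.\<close>

definition cantor_map :: mor where
  "cantor_map = add_map \<cdot> Pair (triangle_map \<cdot> add_map) (Snd Nat Nat)"

text \<open>
  The code of the singleton \<open>n\<close> is \<open>J(0, n)\<close> and the code of the pair of \<open>a\<close> and \<open>b\<close> is
  \<open>J(a + 1, b)\<close>. Singleton codes and pair codes are thus disjoint, and, since
  \<open>a, b < J(a + 1, b)\<close>, every natural number is a code, in a unique way; the predicate cutting out the object of codes is therefore constantly true.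
\<close>

definition is_code :: mor where
  "is_code = true_of Nat"

definition X :: obj where
  "X = Sub Nat is_code"

definition code_single :: mor where
  "code_single = Lift Nat is_code (cantor_map \<cdot> Pair (zero_of Nat) (Id Nat))"

definition code_pair :: mor where
  "code_pair = Lift Nat is_code
     (cantor_map \<cdot> cross X X (Succ \<cdot> Incl Nat is_code) (Incl Nat is_code))"

text \<open>The canonical embeddings of the objects of \<open>PRa\<close>; the point of \<open>1\<close> gets the code of \<open>0\<close>.\<close>

fun code_emb :: "obj \<Rightarrow> mor" where
  "code_emb One = code_single \<cdot> Zero"
| "code_emb Nat = code_single"
| "code_emb (Prod A B) = code_pair \<cdot> cross A B (code_emb A) (code_emb B)"
| "code_emb (Sub A \<chi>) = code_emb A \<cdot> Incl A \<chi>"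


section \<open>The chain of universal objects\<close>

text \<open>The functions of this section are meaningful for indices \<open>n \<ge> 1\<close> only.\<close>

fun U :: "nat \<Rightarrow> obj" where
  "U (Suc 0) = X"
| "U (Suc (Suc n)) = Exp X (U (Suc n))"

text \<open>\<open>emb n : U n \<rightarrow> U (n + 1)\<close> and \<open>ret n : U (n + 1) \<rightarrow> U n\<close>.\<close>

fun emb :: "nat \<Rightarrow> mor" and ret :: "nat \<Rightarrow> mor" where
  "emb (Suc 0) = precomp X X One (Bang X) \<cdot> Conj (Fst X One)"
| "emb (Suc (Suc n)) = precomp X (U (Suc (Suc n))) (U (Suc n)) (ret (Suc n))"
| "ret (Suc 0) = Eps X X \<cdot> Pair (Id (Exp X X)) (code_single \<cdot> Zero \<cdot> Bang (Exp X X))"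
| "ret (Suc (Suc n)) = precomp X (U (Suc n)) (U (Suc (Suc n))) (emb (Suc n))"

text \<open>\<open>extend n k f\<close> is \<open>f : A \<rightarrow> U n\<close> followed by \<open>U n \<rightarrow> U (n + 1) \<rightarrow> \<dots> \<rightarrow> U (n + k)\<close>.\<close>

primrec extend :: "nat \<Rightarrow> nat \<Rightarrow> mor \<Rightarrow> mor" where
  "extend n 0 f = f"
| "extend n (Suc k) f = emb (n + k) \<cdot> extend n k f"

end

theory Submission
  imports Defs
begin

text \<open>
  A pointed object \<open>A\<close> with pointed exponents, of order \<open>k \<le> n\<close>, is a retract of \<open>U k\<close> already
  within the stratum \<open>n\<close>, by induction on \<open>A\<close> (\<open>stratum_embedding\<close>).

  \<^item> \<open>1\<close> and \<open>\<nat>\<close> embed in \<open>X\<close> by singleton codes.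

  \<^item> For a product, both factors are moved up the chain to the same \<open>U k\<close>, and
    \<open>U k \<times> U k\<close> is a retract of \<open>U k\<close>: for \<open>k = 1\<close> by pair codes, for \<open>k > 1\<close> because
    \<open>U k\<close> is a power of \<open>X\<close> and pair codes can be formed pointwise.

  \<^item> A pointed extension \<open>{A | \<chi>}\<close> is a retract of \<open>A\<close>: since \<open>\<chi>\<close> is decidable, everything outside
    of the extension can be sent to the point (\<open>retraction_Sub\<close>).

  \<^item> For \<open>C^B\<close> with \<open>C\<close> in \<open>PRa\<close>, an embedding of \<open>B\<close> in \<open>U k\<close> with retraction \<open>r\<close> and an embedding
    of \<open>C\<close> in \<open>X\<close> combine to \<open>C^B \<rightarrow> C^(U k) \<rightarrow> X^(U k) = U (k + 1)\<close>, where the first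
    map is precomposition with \<open>r\<close>. An iterated exponential \<open>(C^B)^A\<close> is first transported to
    \<open>C^(B \<times> A)\<close> by the canonical isomorphism, because evaluation with values in \<open>C^B\<close> may
    have too high an order for the stratum.

  The chain itself consists of retraction pairs because precomposition exchanges sections and
  retractions (\<open>chain_retraction\<close>), and composing along it carries \<open>U k\<close> to \<open>U n\<close> and \<open>U m\<close>.
  Each step uses evaluation of total order at most \<open>n\<close> only, so everything stays within
  the stratum; part (ii) then follows because the strata increase.

  The arithmetical core is that code pairs can be decoded, that is, that Cantor's
  \<open>J(a, b) = (0 + \<dots> + (a + b)) + b\<close> has a left inverse, where the only means of induction is Freyd's
  uniqueness of the initialised iterated. The decoding walks along the diagonals of \<open>\<nat> \<times> \<nat>\<close>.
  Induction on the position within a diagonal would change the parameter \<open>a\<close> along with \<open>b\<close>, which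
  Freyd's scheme does not provide for. The walk is therefore performed in the coordinates
  \<open>(a, d)\<close> with \<open>d = a + b\<close>: a step sends \<open>(a + 1, d)\<close> to \<open>(a, d)\<close> and is thus a left inverse
  of \<open>(a, d) \<mapsto> (a + 1, d)\<close>, so that their \<open>b\<close>-fold iterates cancel (\<open>iter_section\<close>).

  All derivations in a theory are carried out on representatives of the classes of provably equal
  maps. Provable equality becomes equality of representatives, and can be established by rewriting.
\<close>

section \<open>Typing\<close>

fun prod_left :: "obj \<Rightarrow> obj" where
  "prod_left (Prod A B) = A"
| "prod_left _ = One"

fun prod_right :: "obj \<Rightarrow> obj" where
  "prod_right (Prod A B) = B"
| "prod_right _ = One"

text \<open>
  Types of maps are unique, so that domain and codomain can be read off from the syntax. This turns
  typing into conditions that rewriting can decide, without a search for intermediate objects.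
\<close>
fun dm :: "mor \<Rightarrow> obj" where
  "dm (Id A) = A"
| "dm (g \<cdot> f) = dm f"
| "dm (Bang A) = A"
| "dm Zero = One"
| "dm Succ = Nat"
| "dm (Fst A B) = Prod A B"
| "dm (Snd A B) = Prod A B"
| "dm (Pair f g) = dm f"
| "dm (Iter f) = Prod (dm f) Nat"
| "dm (Incl A \<chi>) = Sub A \<chi>"
| "dm (Lift A \<chi> f) = dm f"
| "dm (Eps A B) = Prod (Exp B A) A"
| "dm (Lam A B) = A"
| "dm (Conj f) = prod_left (dm f)"
| "dm (IsoTo A B C) = Exp (Exp C B) A"
| "dm (IsoFrom A B C) = Exp C (Prod B A)"

fun cd :: "mor \<Rightarrow> obj" where
  "cd (Id A) = A"
| "cd (g \<cdot> f) = cd g"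
| "cd (Bang A) = One"
| "cd Zero = Nat"
| "cd Succ = Nat"
| "cd (Fst A B) = A"
| "cd (Snd A B) = B"
| "cd (Pair f g) = Prod (cd f) (cd g)"
| "cd (Iter f) = cd f"
| "cd (Incl A \<chi>) = A"
| "cd (Lift A \<chi> f) = Sub A \<chi>"
| "cd (Eps A B) = B"
| "cd (Lam A B) = Exp (Prod A B) B"
| "cd (Conj f) = Exp (cd f) (prod_right (dm f))"
| "cd (IsoTo A B C) = Exp C (Prod B A)"
| "cd (IsoFrom A B C) = Exp (Exp C B) A"

lemma Map_dm_cd: "Map T A B f \<Longrightarrow> dm f = A \<and> cd f = B"
  by (induction rule: Obj_Map_Eqn.inducts(2)[where ?P1.0="\<lambda>_. True" and ?P3.0="\<lambda>_ _ _ _. True"])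
    auto

inductive_simps Obj_Prod_iff [simp]: "Obj T (Prod A B)"
inductive_simps Obj_Sub_iff: "Obj T (Sub A \<chi>)"
inductive_simps Obj_Exp_iff: "Obj T (Exp B A)"
inductive_simps Map_Id_iff: "Map T A B (Id C)"
inductive_simps Map_Comp_iff: "Map T A B (g \<cdot> f)"
inductive_simps Map_Bang_iff: "Map T A B (Bang C)"
inductive_simps Map_Zero_iff: "Map T A B Zero"
inductive_simps Map_Succ_iff: "Map T A B Succ"
inductive_simps Map_Fst_iff: "Map T A B (Fst C D)"
inductive_simps Map_Snd_iff: "Map T A B (Snd C D)"
inductive_simps Map_Pair_iff: "Map T A B (Pair f g)"
inductive_simps Map_Iter_iff: "Map T A B (Iter f)"
inductive_simps Map_Incl_iff: "Map T A B (Incl C \<chi>)"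
inductive_simps Map_Lift_iff: "Map T A B (Lift C \<chi> f)"
inductive_simps Map_Eps_iff: "Map T A B (Eps C D)"
inductive_simps Map_Conj_iff: "Map T A B (Conj f)"


lemma Map_wf:
  "Obj T A \<Longrightarrow> True"
  "Map T A B f \<Longrightarrow> Obj T A \<and> Obj T B"
  "Eqn T A B f g \<Longrightarrow> Map T A B f \<and> Map T A B g"
  by (induction rule: Obj_Map_Eqn.inducts)
    (auto intro!: Obj_Map_Eqn.intros(1-21) simp: zero_of_def true_of_def cross_def coconj_def
      Obj_Sub_iff elim: Obj.cases)

lemmas Map_Obj = Map_wf(2)
lemmas Eqn_Map = Map_wf(3)

section \<open>Representatives of provable equality\<close>

locale pr_theory =
  fixes T :: thy
begin

definition wt :: "mor \<Rightarrow> bool" where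
  "wt f \<longleftrightarrow> Map T (dm f) (cd f) f"

lemma Map_iff: "Map T A B f \<longleftrightarrow> wt f \<and> dm f = A \<and> cd f = B"
  using Map_dm_cd wt_def by blast

lemma wt_Obj [simp]: "wt f \<Longrightarrow> Obj T (dm f)" "wt f \<Longrightarrow> Obj T (cd f)"
  using Map_Obj wt_def by blast+

text \<open>
  \<open>nf f\<close> is one representative for all maps provably equal to \<open>f\<close>. Ill-typed terms stay as they
  are: then domain, codomain and typability of \<open>nf f\<close> are those of \<open>f\<close> without exception.
\<close>
definition nf :: "mor \<Rightarrow> mor" where
  "nf f = (if wt f then SOME g. Eqn T (dm f) (cd f) f g else f)"

lemma Eqn_nf: "Map T A B f \<Longrightarrow> Eqn T A B f (nf f)"
  unfolding nf_def Map_iff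
  by (auto intro!: someI[where P="Eqn T (dm f) (cd f) f"] eq_refl simp: Map_iff)

lemma nf_cong: "Eqn T A B f g \<Longrightarrow> nf f = nf g"
proof -
  assume e: "Eqn T A B f g"
  then have m: "Map T A B f" "Map T A B g" using Eqn_Map by auto
  moreover have "Eqn T A B f = Eqn T A B g"
    using e by (blast intro: eq_sym eq_trans)
  ultimately show ?thesis by (simp add: nf_def Map_iff)
qed

lemma Eqn_iff: "Eqn T A B f g \<longleftrightarrow> Map T A B f \<and> Map T A B g \<and> nf f = nf g"
  by (metis Eqn_Map Eqn_nf eq_sym eq_trans nf_cong)

lemma dm_nf [simp]: "dm (nf f) = dm f" and cd_nf [simp]: "cd (nf f) = cd f"
proof -
  have "dm (nf f) = dm f \<and> cd (nf f) = cd f"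
  proof (cases "wt f")
    case True
    then show ?thesis using Eqn_Map[OF Eqn_nf[of "dm f" "cd f" f]] by (simp add: Map_iff)
  qed (simp add: nf_def)
  then show "dm (nf f) = dm f" "cd (nf f) = cd f" by auto
qed

lemma wt_nf [simp]: "wt (nf f) = wt f"
proof (cases "wt f")
  case True
  then show ?thesis using Eqn_Map[OF Eqn_nf[of "dm f" "cd f" f]] by (simp add: Map_iff)
qed (simp add: nf_def)

lemma nf_nf [simp]: "nf (nf f) = nf f"
proof (cases "wt f")
  case True
  then show ?thesis using nf_cong[OF Eqn_nf[of "dm f" "cd f" f]] by (simp add: Map_iff)
qed (simp add: nf_def)

text \<open>
  The operations pass to representatives of their arguments as well, so that \<open>nf\<close> is absorbed
  everywhere except at the root of a term (\<open>nf_absorb\<close>), also for ill-typed arguments.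
\<close>
definition comp :: "mor \<Rightarrow> mor \<Rightarrow> mor" (infixr "\<bullet>" 65) where
  "g \<bullet> f = nf (nf g \<cdot> nf f)"

definition pair :: "mor \<Rightarrow> mor \<Rightarrow> mor" ("\<langle>_, _\<rangle>") where
  "\<langle>f, g\<rangle> = nf (Pair (nf f) (nf g))"

definition iter :: "mor \<Rightarrow> mor" where
  "iter f = nf (Iter (nf f))"

definition conj :: "mor \<Rightarrow> mor" where
  "conj f = nf (Conj (nf f))"

definition lift :: "obj \<Rightarrow> mor \<Rightarrow> mor \<Rightarrow> mor" where
  "lift A \<chi> f = nf (Lift A \<chi> (nf f))"

lemma wt_raw [simp]:
  "wt (Id A) \<longleftrightarrow> Obj T A"
  "wt (Bang A) \<longleftrightarrow> Obj T A"
  "wt Zero"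
  "wt Succ"
  "wt (Fst A B) \<longleftrightarrow> Obj T A \<and> Obj T B"
  "wt (Snd A B) \<longleftrightarrow> Obj T A \<and> Obj T B"
  "wt (Iter f) \<longleftrightarrow> wt f \<and> dm f = cd f"
  "wt (Incl A \<chi>) \<longleftrightarrow> Obj T (Sub A \<chi>)"
  "wt (Eps A B) \<longleftrightarrow> Obj T (Exp B A) \<and> has_eps T A B"
  by (auto simp: wt_def Map_Id_iff Map_Bang_iff Map_Zero_iff Map_Succ_iff Map_Fst_iff
      Map_Snd_iff Map_Iter_iff Map_Incl_iff Map_Eps_iff
      Obj_Sub_iff Obj_Exp_iff dest: Map_dm_cd Map_Obj)

lemma wt_Comp [simp]: "wt (g \<cdot> f) \<longleftrightarrow> wt g \<and> wt f \<and> dm g = cd f"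
proof -
  have "wt (g \<cdot> f) \<longleftrightarrow> (\<exists>B. Map T (dm f) B f \<and> Map T B (cd g) g)"
    by (simp add: wt_def Map_Comp_iff)
  then show ?thesis by (auto simp: Map_iff)
qed

lemma wt_Pair [simp]: "wt (Pair f g) \<longleftrightarrow> wt f \<and> wt g \<and> dm f = dm g"
proof -
  have "wt (Pair f g) \<longleftrightarrow> Map T (dm f) (cd f) f \<and> Map T (dm f) (cd g) g"
    by (simp add: wt_def Map_Pair_iff)
  then show ?thesis by (auto simp: Map_iff)
qed

lemma wt_Conj [simp]:
  "wt (Conj f) \<longleftrightarrow> (\<exists>A B. dm f = Prod A B \<and> wt f \<and> Obj T (Exp (cd f) B) \<and> has_eps T B (cd f))"
proof -
  have "wt (Conj f) \<longleftrightarrow> Map T (prod_left (dm f)) (Exp (cd f) (prod_right (dm f))) (Conj f)"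
    by (simp add: wt_def)
  also have "\<dots> \<longleftrightarrow> (\<exists>A B. dm f = Prod A B \<and> wt f \<and> Obj T (Exp (cd f) B) \<and> has_eps T B (cd f))"
    unfolding Map_Conj_iff Map_iff by (auto simp: Obj_Exp_iff dest: wt_Obj)
  finally show ?thesis .
qed

lemma dm_cd_op [simp]:
  "dm (g \<bullet> f) = dm f" "cd (g \<bullet> f) = cd g"
  "dm \<langle>f, g\<rangle> = dm f" "cd \<langle>f, g\<rangle> = Prod (cd f) (cd g)"
  "dm (iter f) = Prod (dm f) Nat" "cd (iter f) = cd f"
  "dm (conj f) = prod_left (dm f)" "cd (conj f) = Exp (cd f) (prod_right (dm f))"
  "dm (lift A \<chi> f) = dm f" "cd (lift A \<chi> f) = Sub A \<chi>"
  by (simp_all add: comp_def pair_def iter_def conj_def lift_def)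

lemma wt_op [simp]:
  "wt (g \<bullet> f) \<longleftrightarrow> wt g \<and> wt f \<and> dm g = cd f"
  "wt \<langle>f, g\<rangle> \<longleftrightarrow> wt f \<and> wt g \<and> dm f = dm g"
  "wt (iter f) \<longleftrightarrow> wt f \<and> dm f = cd f"
  "wt (conj f) \<longleftrightarrow> (\<exists>A B. dm f = Prod A B \<and> wt f \<and> Obj T (Exp (cd f) B) \<and> has_eps T B (cd f))"
  by (simp_all add: comp_def pair_def iter_def conj_def)

lemma nf_absorb [simp]:
  "nf (g \<bullet> f) = g \<bullet> f" "nf g \<bullet> f = g \<bullet> f" "g \<bullet> nf f = g \<bullet> f"
  "nf \<langle>f, g\<rangle> = \<langle>f, g\<rangle>" "\<langle>nf f, g\<rangle> = \<langle>f, g\<rangle>" "\<langle>f, nf g\<rangle> = \<langle>f, g\<rangle>"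
  "nf (iter f) = iter f" "iter (nf f) = iter f"
  "nf (conj f) = conj f" "conj (nf f) = conj f"
  "nf (lift A \<chi> f) = lift A \<chi> f" "lift A \<chi> (nf f) = lift A \<chi> f"
  by (simp_all add: comp_def pair_def iter_def conj_def lift_def)

lemma nf_Comp: "wt (g \<cdot> f) \<Longrightarrow> nf (g \<cdot> f) = nf g \<bullet> nf f"
  unfolding comp_def nf_nf
  by (rule nf_cong[of "dm f" "cd g"]) (auto intro!: eq_Comp[of _ _ "cd f"] Eqn_nf simp: Map_iff)

lemma nf_Pair: "wt (Pair f g) \<Longrightarrow> nf (Pair f g) = \<langle>nf f, nf g\<rangle>"
  unfolding pair_def nf_nf
  by (rule nf_cong[of "dm f" "Prod (cd f) (cd g)"]) (auto intro!: eq_Pair Eqn_nf simp: Map_iff)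

lemma nf_Iter: "wt (Iter f) \<Longrightarrow> nf (Iter f) = iter (nf f)"
  unfolding iter_def nf_nf
  by (rule nf_cong[of "Prod (dm f) Nat" "dm f"]) (auto intro!: eq_Iter Eqn_nf simp: Map_iff)

lemma nf_Conj:
  assumes "wt (Conj f)" shows "nf (Conj f) = conj (nf f)"
proof -
  have "\<exists>A B. dm f = Prod A B \<and> wt f \<and> Obj T (Exp (cd f) B) \<and> has_eps T B (cd f)"
    using assms unfolding wt_Conj .
  then obtain A B where d: "dm f = Prod A B" and h: "wt f" "Obj T (Exp (cd f) B)" "has_eps T B (cd f)"
    by blast
  have 1: "Map T A (Exp (cd f) B) (Conj f)" unfolding Map_iff using d h by simp
  have 2: "Map T A (Exp (cd f) B) (Conj (nf f))" unfolding Map_iff using d h by simp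
  have 3: "Eqn T (Prod A B) (cd f) f (nf f)"
    by (rule Eqn_nf) (simp add: Map_iff d h)
  have "nf (Conj f) = nf (Conj (nf f))"
    by (rule nf_cong, rule eq_Conj, rule 1, rule 2, rule 3)
  then show ?thesis by (simp add: conj_def)
qed
lemma Obj_SubD:
  assumes "Obj T (Sub A \<chi>)"
  shows "wt \<chi>" "dm \<chi> = A" "cd \<chi> = Nat" "Obj T A"
  using assms by (auto simp: Obj_Sub_iff Map_iff)

lemma wt_Lift:
  "wt (Lift A \<chi> f) \<longleftrightarrow> Obj T (Sub A \<chi>) \<and> wt f \<and> cd f = A \<and> \<chi> \<bullet> f = Succ \<bullet> Zero \<bullet> Bang (dm f)"
proof -
  have "wt (Lift A \<chi> f) \<longleftrightarrow> Map T (dm f) (Sub A \<chi>) (Lift A \<chi> f)"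
    by (simp add: wt_def)
  also have "\<dots> \<longleftrightarrow> Obj T (Sub A \<chi>) \<and> Map T (dm f) A f \<and> Eqn T (dm f) Nat (\<chi> \<cdot> f) (true_of (dm f))"
    by (simp add: Map_Lift_iff)
  also have "\<dots> \<longleftrightarrow> Obj T (Sub A \<chi>) \<and> wt f \<and> cd f = A \<and> \<chi> \<bullet> f = Succ \<bullet> Zero \<bullet> Bang (dm f)"
  proof (cases "Obj T (Sub A \<chi>) \<and> wt f \<and> cd f = A")
    case True
    note c = Obj_SubD[of A \<chi>]
    have "nf (\<chi> \<cdot> f) = \<chi> \<bullet> f" using True c by (simp add: nf_Comp)
    moreover have "nf (true_of (dm f)) = Succ \<bullet> Zero \<bullet> Bang (dm f)"
      using True by (simp add: true_of_def nf_Comp)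
    ultimately show ?thesis using True c by (simp add: Eqn_iff Map_iff true_of_def)
  qed (auto simp: Map_iff)
  finally show ?thesis .
qed

lemma nf_Lift:
  assumes "wt (Lift A \<chi> f)" shows "nf (Lift A \<chi> f) = lift A \<chi> (nf f)"
  unfolding lift_def nf_nf using assms
  by (intro nf_cong[of "dm f" "Sub A \<chi>"] eq_Lift Eqn_nf) (simp_all add: Map_iff wt_Lift)

lemma wt_lift [simp]:
  "wt (lift A \<chi> f) \<longleftrightarrow> Obj T (Sub A \<chi>) \<and> wt f \<and> cd f = A \<and> \<chi> \<bullet> f = Succ \<bullet> Zero \<bullet> Bang (dm f)"
  by (simp add: lift_def wt_Lift)

lemmas nf_syntax = nf_Comp nf_Pair nf_Iter nf_Conj nf_Lift

text \<open>
  The laws of the theory as rewrite rules on representatives. Compositions are nested to the right, and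
  a map is applied to generalised elements: a rule such as \<open>iter_succ\<close> is the axiom composed with
  an arbitrary pair of maps into the domain.
\<close>
lemma comp_assoc [simp]:
  assumes "wt h" "wt g" "wt f" "dm h = cd g" "dm g = cd f"
  shows "(h \<bullet> g) \<bullet> f = h \<bullet> g \<bullet> f"
proof -
  have "nf ((h \<cdot> g) \<cdot> f) = nf (h \<cdot> (g \<cdot> f))"
    using assms by (intro nf_cong[of "dm f" "cd h"] assoc[of _ _ "cd f" _ "cd g"]) (simp_all add: Map_iff)
  then show ?thesis using assms by (simp add: nf_syntax)
qed

lemma id_comp [simp]:
  assumes "wt f" "cd f = A" shows "Id A \<bullet> f = nf f"
proof -
  have "nf (Id A \<cdot> f) = nf f"
    using assms by (intro nf_cong[of "dm f" "cd f"]) (auto intro: id_left simp: Map_iff)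
  then show ?thesis using assms by (auto simp: nf_syntax)
qed

lemma comp_id [simp]:
  assumes "wt f" "dm f = A" shows "f \<bullet> Id A = nf f"
proof -
  have "nf (f \<cdot> Id A) = nf f"
    using assms by (intro nf_cong[of "dm f" "cd f"]) (auto intro: id_right simp: Map_iff)
  then show ?thesis using assms by (auto simp: nf_syntax)
qed

lemma nf_terminal:
  assumes "wt f" "cd f = One" shows "nf f = nf (Bang (dm f))"
  using assms by (intro nf_cong[of "dm f" One]) (auto intro: terminal simp: Map_iff)

lemma bang_comp [simp]:
  assumes "wt f" "cd f = A" shows "Bang A \<bullet> f = nf (Bang (dm f))"
  using nf_terminal[of "Bang A \<bullet> f"] assms by auto

lemma fst_pair [simp]:
  assumes "wt f" "wt g" "dm f = dm g" "cd f = A" "cd g = B"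
  shows "Fst A B \<bullet> \<langle>f, g\<rangle> = nf f"
proof -
  have "nf (Fst A B \<cdot> Pair f g) = nf f"
    using assms by (intro nf_cong[of "dm f" "cd f"]) (auto intro: fst_Pair simp: Map_iff)
  then show ?thesis using assms by (auto simp: nf_syntax)
qed

lemma snd_pair [simp]:
  assumes "wt f" "wt g" "dm f = dm g" "cd f = A" "cd g = B"
  shows "Snd A B \<bullet> \<langle>f, g\<rangle> = nf g"
proof -
  have "nf (Snd A B \<cdot> Pair f g) = nf g"
    using assms by (intro nf_cong[of "dm f" "cd g"]) (auto intro: snd_Pair simp: Map_iff)
  then show ?thesis using assms by (auto simp: nf_syntax)
qed

lemma pair_eta [simp]:
  assumes "wt h" "cd h = Prod A B"
  shows "\<langle>Fst A B \<bullet> h, Snd A B \<bullet> h\<rangle> = nf h"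
proof -
  have "Obj T (Prod A B)" using assms wt_Obj by metis
  then have "nf (Pair (Fst A B \<cdot> h) (Snd A B \<cdot> h)) = nf h"
    using assms by (intro nf_cong[of "dm h" "Prod A B"]) (auto intro: surj_Pair simp: Map_iff)
  then show ?thesis using assms \<open>Obj T (Prod A B)\<close> by (auto simp: nf_syntax)
qed

lemma pair_eqI:
  assumes "wt h" "wt k" "cd h = Prod A B" "cd k = Prod A B"
    "Fst A B \<bullet> h = Fst A B \<bullet> k" "Snd A B \<bullet> h = Snd A B \<bullet> k"
  shows "nf h = nf k"
  using pair_eta[of h A B] pair_eta[of k A B] assms by simp

lemma pair_comp [simp]:
  assumes "wt f" "wt g" "wt x" "dm f = dm g" "dm f = cd x"
  shows "\<langle>f, g\<rangle> \<bullet> x = \<langle>f \<bullet> x, g \<bullet> x\<rangle>"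
proof -
  have o: "Obj T (cd f)" "Obj T (cd g)" using assms by auto
  have "Fst (cd f) (cd g) \<bullet> \<langle>f, g\<rangle> \<bullet> x = (Fst (cd f) (cd g) \<bullet> \<langle>f, g\<rangle>) \<bullet> x"
     "Snd (cd f) (cd g) \<bullet> \<langle>f, g\<rangle> \<bullet> x = (Snd (cd f) (cd g) \<bullet> \<langle>f, g\<rangle>) \<bullet> x"
    using assms o by (simp_all del: fst_pair snd_pair)
  then have "nf (\<langle>f, g\<rangle> \<bullet> x) = nf \<langle>f \<bullet> x, g \<bullet> x\<rangle>"
    using assms o by (intro pair_eqI[of _ _ "cd f" "cd g"]) simp_all
  then show ?thesis by simp
qed

lemma pair_id [simp]: "Obj T A \<Longrightarrow> Obj T B \<Longrightarrow> \<langle>Fst A B, Snd A B\<rangle> = nf (Id (Prod A B))"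
  using pair_eta[of "Id (Prod A B)" A B] by simp

lemma nf_cross:
  assumes "wt f" "wt g" "dm f = A" "dm g = B"
  shows "nf (cross A B f g) = \<langle>f \<bullet> Fst A B, g \<bullet> Snd A B\<rangle>"
  using assms by (auto simp: cross_def nf_syntax)

lemma iter_zero [simp]:
  assumes "wt f" "dm f = cd f" "wt a" "cd a = cd f" "dm a = D"
  shows "iter f \<bullet> \<langle>a, Zero \<bullet> Bang D\<rangle> = nf a"
proof -
  have "nf (Iter f \<cdot> Pair (Id (cd f)) (zero_of (cd f))) = nf (Id (cd f))"
    using assms by (intro nf_cong[of "cd f" "cd f"] Obj_Map_Eqn.iter_zero) (auto simp: Map_iff)
  then have "iter f \<bullet> \<langle>Id (cd f), Zero \<bullet> Bang (cd f)\<rangle> = nf (Id (cd f))"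
    using assms by (simp add: nf_syntax zero_of_def)
  then have "(iter f \<bullet> \<langle>Id (cd f), Zero \<bullet> Bang (cd f)\<rangle>) \<bullet> a = nf a"
    using assms by simp
  then show ?thesis using assms by auto
qed

lemma iter_succ [simp]:
  assumes "wt f" "dm f = cd f" "wt a" "cd a = cd f" "wt n" "cd n = Nat" "dm a = dm n"
  shows "iter f \<bullet> \<langle>a, Succ \<bullet> n\<rangle> = f \<bullet> iter f \<bullet> \<langle>a, n\<rangle>"
proof -
  have "nf (Iter f \<cdot> cross (cd f) Nat (Id (cd f)) Succ) = nf (f \<cdot> Iter f)"
    using assms by (intro nf_cong[of "Prod (cd f) Nat" "cd f"] Obj_Map_Eqn.iter_succ) (auto simp: Map_iff)
  then have "iter f \<bullet> \<langle>Fst (cd f) Nat, Succ \<bullet> Snd (cd f) Nat\<rangle> = f \<bullet> iter f"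
    using assms by (simp add: nf_syntax nf_cross cross_def obj_Nat)
  then have "(iter f \<bullet> \<langle>Fst (cd f) Nat, Succ \<bullet> Snd (cd f) Nat\<rangle>) \<bullet> \<langle>a, n\<rangle> = (f \<bullet> iter f) \<bullet> \<langle>a, n\<rangle>"
    by simp
  then show ?thesis using assms by (auto simp: obj_Nat)
qed

text \<open>
  Freyd's axiom gives a formula for \<open>h\<close> in terms of its initial value and its step. Two maps that
  agree in these are therefore equal, and this is the induction principle used below.
\<close>
lemma freyd_unique:
  assumes h: "wt h" "dm h = Prod A Nat" "cd h = B" and k: "wt k" "dm k = Prod A Nat" "cd k = B"
    and g: "wt g" "dm g = B" "cd g = B"
    and z: "h \<bullet> \<langle>Id A, Zero \<bullet> Bang A\<rangle> = k \<bullet> \<langle>Id A, Zero \<bullet> Bang A\<rangle>"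
    and hs: "h \<bullet> \<langle>Fst A Nat, Succ \<bullet> Snd A Nat\<rangle> = g \<bullet> h"
    and ks: "k \<bullet> \<langle>Fst A Nat, Succ \<bullet> Snd A Nat\<rangle> = g \<bullet> k"
  shows "nf h = nf k"
proof -
  have o: "Obj T A" "Obj T B" "Obj T Nat" using wt_Obj[OF h(1)] h(2,3) by auto
  define f where "f = k \<bullet> \<langle>Id A, Zero \<bullet> Bang A\<rangle>"
  have f: "wt f" "dm f = A" "cd f = B" using o k by (simp_all add: f_def)
  have "nf j = nf (Iter g \<cdot> cross A Nat f (Id Nat))"
    if "wt j" "dm j = Prod A Nat" "cd j = B" "j \<bullet> \<langle>Id A, Zero \<bullet> Bang A\<rangle> = f"
       "j \<bullet> \<langle>Fst A Nat, Succ \<bullet> Snd A Nat\<rangle> = g \<bullet> j" for j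
  proof -
    have "Eqn T A B (j \<cdot> Pair (Id A) (zero_of A)) f"
      using that o f by (auto simp: Eqn_iff Map_iff zero_of_def nf_syntax)
    moreover have "Eqn T (Prod A Nat) B (j \<cdot> cross A Nat (Id A) Succ) (g \<cdot> j)"
      using that o f g by (auto simp: Eqn_iff Map_iff nf_syntax nf_cross cross_def)
    ultimately show ?thesis
      using that o f g by (intro nf_cong[of "Prod A Nat" B] freyd) (auto simp: Map_iff)
  qed
  from this[OF h] this[OF k] z hs ks show ?thesis by (simp add: f_def)
qed


lemma true_comp:
  assumes "Obj T (Sub A \<chi>)" "wt f" "cd f = A" "\<chi> \<bullet> f = Succ \<bullet> Zero \<bullet> Bang (dm f)" "wt x" "cd x = dm f"
  shows "\<chi> \<bullet> f \<bullet> x = Succ \<bullet> Zero \<bullet> Bang (dm x)"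
proof -
  have "\<chi> \<bullet> f \<bullet> x = (\<chi> \<bullet> f) \<bullet> x"
    using assms Obj_SubD[OF assms(1)] by (intro comp_assoc[symmetric]) simp_all
  also have "\<dots> = (Succ \<bullet> Zero \<bullet> Bang (dm f)) \<bullet> x" using assms by (simp only:)
  also have "\<dots> = Succ \<bullet> Zero \<bullet> Bang (dm x)" using assms by simp
  finally show ?thesis .
qed

lemma chi_incl [simp]:
  assumes "Obj T (Sub A \<chi>)" shows "\<chi> \<bullet> Incl A \<chi> = Succ \<bullet> Zero \<bullet> Bang (Sub A \<chi>)"
proof -
  note d = Obj_SubD[OF assms]
  have "nf (\<chi> \<cdot> Incl A \<chi>) = nf (true_of (Sub A \<chi>))"
    using assms d by (intro nf_cong[of "Sub A \<chi>" Nat] incl_true)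
  then show ?thesis using assms d by (simp add: nf_syntax true_of_def)
qed

lemma incl_lift [simp]:
  assumes "wt (lift A \<chi> f)" shows "Incl A \<chi> \<bullet> lift A \<chi> f = nf f"
proof -
  have w: "wt (Lift A \<chi> f)" using assms by (simp add: wt_Lift)
  then have "nf (Incl A \<chi> \<cdot> Lift A \<chi> f) = nf f"
    by (intro nf_cong[of "dm f" A] Obj_Map_Eqn.incl_Lift) (simp_all add: Map_iff wt_Lift)
  then show ?thesis using w by (simp add: nf_syntax wt_Lift)
qed

lemma incl_inject:
  assumes "wt g" "wt h" "cd g = Sub A \<chi>" "cd h = Sub A \<chi>" "dm g = dm h"
    "Incl A \<chi> \<bullet> g = Incl A \<chi> \<bullet> h"
  shows "nf g = nf h"
proof -
  have o: "Obj T (Sub A \<chi>)" using assms wt_Obj by metis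
  then have "Eqn T (dm g) A (Incl A \<chi> \<cdot> g) (Incl A \<chi> \<cdot> h)"
    using assms by (simp add: Eqn_iff Map_iff nf_syntax)
  then show ?thesis using assms by (intro nf_cong[OF incl_mono]) (auto simp: Map_iff)
qed

lemma lift_incl [simp]:
  assumes "wt x" "cd x = Sub A \<chi>" shows "lift A \<chi> (Incl A \<chi> \<bullet> x) = nf x"
proof -
  have o: "Obj T (Sub A \<chi>)" using assms wt_Obj by metis
  note true_comp[of A \<chi> "Incl A \<chi>" x]
  then have "nf (lift A \<chi> (Incl A \<chi> \<bullet> x)) = nf x"
    using assms o by (intro incl_inject[of _ _ A \<chi>]) simp_all
  then show ?thesis by simp
qed

lemma lift_comp [simp]:
  assumes "wt (lift A \<chi> f)" "wt x" "cd x = dm f"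
  shows "lift A \<chi> f \<bullet> x = lift A \<chi> (f \<bullet> x)"
proof -
  have o: "Obj T (Sub A \<chi>)" using assms by simp
  note t = true_comp[of A \<chi> f x]
  have "Incl A \<chi> \<bullet> lift A \<chi> f \<bullet> x = (Incl A \<chi> \<bullet> lift A \<chi> f) \<bullet> x"
    using assms by (intro comp_assoc[symmetric]) simp_all
  also have "\<dots> = f \<bullet> x" using assms by simp
  finally have "nf (lift A \<chi> f \<bullet> x) = nf (lift A \<chi> (f \<bullet> x))"
    using assms o t by (intro incl_inject[of _ _ A \<chi>]) simp_all
  then show ?thesis by simp
qed

lemma eps_conj [simp]:
  assumes "wt (conj f)" "dm f = Prod A B" "cd f = C" "wt x" "wt b" "cd x = A" "cd b = B" "dm x = dm b"
  shows "Eps B C \<bullet> \<langle>conj f \<bullet> x, b\<rangle> = f \<bullet> \<langle>x, b\<rangle>"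
proof -
  have h: "wt f" "Obj T (Exp C B)" "has_eps T B C" using assms by auto
  have o: "Obj T A" "Obj T B" using assms wt_Obj by metis+
  have m: "Map T A (Exp C B) (Conj f)" "Map T (Prod A B) C f" "Map T (Prod (Exp C B) B) C (Eps B C)"
    using assms h by (simp_all add: Map_iff)
  have w: "wt (Conj f)" using m by (simp add: Map_iff)
  have "nf (coconj A B C (Conj f)) = nf f"
    by (rule nf_cong, rule coconj_Conj, rule m(1), rule m(2), rule m(3))
  then have "Eps B C \<bullet> \<langle>conj f \<bullet> Fst A B, Snd A B\<rangle> = nf f"
    using assms h o w by (simp add: coconj_def cross_def nf_syntax)
  then have "(Eps B C \<bullet> \<langle>conj f \<bullet> Fst A B, Snd A B\<rangle>) \<bullet> \<langle>x, b\<rangle> = f \<bullet> \<langle>x, b\<rangle>"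
    by simp
  then show ?thesis using assms h o by simp
qed

lemma eps_conj_id [simp]:
  assumes "wt (conj f)" "dm f = Prod A B" "cd f = C" "wt b" "cd b = B" "dm b = A"
  shows "Eps B C \<bullet> \<langle>conj f, b\<rangle> = f \<bullet> \<langle>Id A, b\<rangle>"
proof -
  have o: "Obj T A" using assms wt_Obj by metis
  have "conj f \<bullet> Id A = conj f" using assms by simp
  then show ?thesis using eps_conj[of f A B C "Id A" b] assms o by simp
qed

lemma conj_eps [simp]:
  assumes "wt g" "cd g = Exp C B" "has_eps T B C" "dm g = A"
  shows "conj (Eps B C \<bullet> \<langle>g \<bullet> Fst A B, Snd A B\<rangle>) = nf g"
proof -
  have o: "Obj T (Exp C B)" "Obj T A" using assms wt_Obj by metis+
  then have o': "Obj T B" "Obj T C" by (simp_all add: Obj_Exp_iff)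
  let ?f = "coconj A B C g"
  have f: "dm ?f = Prod A B" "cd ?f = C" "wt ?f"
    using assms o o' by (simp_all add: coconj_def cross_def)
  have w: "wt (Conj ?f)" using f o assms by simp
  have "nf (Conj ?f) = nf g"
    using f w assms o by (intro nf_cong[of A "Exp C B"] Conj_coconj) (simp_all add: Map_iff)
  moreover have "nf ?f = Eps B C \<bullet> \<langle>g \<bullet> Fst A B, Snd A B\<rangle>"
    using assms o o' by (simp add: coconj_def cross_def nf_syntax)
  ultimately show ?thesis using nf_Conj[OF w] by simp
qed

section \<open>Iteration\<close>

lemma obj_basic [simp]: "Obj T One" "Obj T Nat"
  by (rule obj_One, rule obj_Nat)

lemma freyd_unique_comp:
  assumes "wt h" "dm h = Prod A Nat" "cd h = B" "wt k" "dm k = Prod A Nat" "cd k = B"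
    "wt g" "dm g = B" "cd g = B"
    "h \<bullet> \<langle>Id A, Zero \<bullet> Bang A\<rangle> = k \<bullet> \<langle>Id A, Zero \<bullet> Bang A\<rangle>"
    "h \<bullet> \<langle>Fst A Nat, Succ \<bullet> Snd A Nat\<rangle> = g \<bullet> h"
    "k \<bullet> \<langle>Fst A Nat, Succ \<bullet> Snd A Nat\<rangle> = g \<bullet> k"
  shows "h \<bullet> x = k \<bullet> x"
  using freyd_unique[OF assms] nf_absorb(2) by metis

text \<open>
  Here the step may depend on the arguments \<open>(a, n)\<close> too. This reduces to Freyd's scheme by
  carrying the arguments along in the state.
\<close>
lemma prim_rec_unique:
  assumes h: "wt h" "dm h = Prod A Nat" "cd h = B" and k: "wt k" "dm k = Prod A Nat" "cd k = B"
    and g: "wt g" "dm g = Prod (Prod A Nat) B" "cd g = B"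
    and z: "h \<bullet> \<langle>Id A, Zero \<bullet> Bang A\<rangle> = k \<bullet> \<langle>Id A, Zero \<bullet> Bang A\<rangle>"
    and hs: "h \<bullet> \<langle>Fst A Nat, Succ \<bullet> Snd A Nat\<rangle> = g \<bullet> \<langle>Id (Prod A Nat), h\<rangle>"
    and ks: "k \<bullet> \<langle>Fst A Nat, Succ \<bullet> Snd A Nat\<rangle> = g \<bullet> \<langle>Id (Prod A Nat), k\<rangle>"
  shows "nf h = nf k"
proof -
  let ?P = "Prod A Nat"
  let ?step = "\<langle>\<langle>Fst A Nat \<bullet> Fst ?P B, Succ \<bullet> Snd A Nat \<bullet> Fst ?P B\<rangle>, g\<rangle>"
  have o: "Obj T A" "Obj T B" using wt_Obj[OF h(1)] h(2,3) by auto
  have "nf \<langle>Id ?P, h\<rangle> = nf \<langle>Id ?P, k\<rangle>"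
    using o h k g z hs ks
    by (intro freyd_unique[where A=A and B="Prod ?P B" and g="?step"]) simp_all
  then have "Snd ?P B \<bullet> \<langle>Id ?P, h\<rangle> = Snd ?P B \<bullet> \<langle>Id ?P, k\<rangle>" by simp
  then show ?thesis using o h k by simp
qed

text \<open>
  Case distinction between zero and successor is recursion with a step that ignores
  the previous value.
\<close>
lemma case_unique:
  assumes h: "wt h" "dm h = Prod A Nat" "cd h = B" and k: "wt k" "dm k = Prod A Nat" "cd k = B"
    and z: "h \<bullet> \<langle>Id A, Zero \<bullet> Bang A\<rangle> = k \<bullet> \<langle>Id A, Zero \<bullet> Bang A\<rangle>"
    and s: "h \<bullet> \<langle>Fst A Nat, Succ \<bullet> Snd A Nat\<rangle> = k \<bullet> \<langle>Fst A Nat, Succ \<bullet> Snd A Nat\<rangle>"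
  shows "nf h = nf k"
proof -
  have o: "Obj T A" "Obj T B" using wt_Obj[OF h(1)] h(2,3) by auto
  show ?thesis
    using o h k z s
    by (intro prim_rec_unique[where A=A and B=B and g="(k \<bullet> \<langle>Fst A Nat, Succ \<bullet> Snd A Nat\<rangle>) \<bullet> Fst (Prod A Nat) B"]) simp_all
qed

lemma iter_comm:
  assumes "wt f" "dm f = cd f" "wt a" "cd a = cd f" "wt n" "cd n = Nat" "dm a = dm n"
  shows "iter f \<bullet> \<langle>f \<bullet> a, n\<rangle> = f \<bullet> iter f \<bullet> \<langle>a, n\<rangle>"
  using freyd_unique_comp[of "iter f \<bullet> \<langle>f \<bullet> Fst (cd f) Nat, Snd (cd f) Nat\<rangle>" "cd f" "cd f"
      "f \<bullet> iter f" f "\<langle>a, n\<rangle>"] assms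
  by simp

lemma iter_add [simp]:
  assumes "wt f" "dm f = cd f" "wt a" "cd a = cd f" "wt m" "cd m = Nat" "wt n" "cd n = Nat"
    "dm a = dm n" "dm m = dm n"
  shows "iter f \<bullet> \<langle>a, iter Succ \<bullet> \<langle>m, n\<rangle>\<rangle> = iter f \<bullet> \<langle>iter f \<bullet> \<langle>a, m\<rangle>, n\<rangle>"
  using freyd_unique_comp[of "iter f \<bullet> \<langle>Fst (cd f) Nat \<bullet> Fst (Prod (cd f) Nat) Nat,
         iter Succ \<bullet> \<langle>Snd (cd f) Nat \<bullet> Fst (Prod (cd f) Nat) Nat, Snd (Prod (cd f) Nat) Nat\<rangle>\<rangle>"
      "Prod (cd f) Nat" "cd f"
      "iter f \<bullet> \<langle>iter f \<bullet> Fst (Prod (cd f) Nat) Nat, Snd (Prod (cd f) Nat) Nat\<rangle>" f "\<langle>\<langle>a, m\<rangle>, n\<rangle>"] assms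
  by simp

lemma iter_natural:
  assumes "wt f" "dm f = cd f" "wt g" "dm g = cd g" "wt p" "dm p = cd f" "cd p = cd g"
    and c: "\<And>x. wt x \<Longrightarrow> cd x = cd f \<Longrightarrow> p \<bullet> f \<bullet> x = g \<bullet> p \<bullet> x"
    and "wt a" "cd a = cd f" "wt n" "cd n = Nat" "dm a = dm n"
  shows "p \<bullet> iter f \<bullet> \<langle>a, n\<rangle> = iter g \<bullet> \<langle>p \<bullet> a, n\<rangle>"
  using freyd_unique_comp[of "p \<bullet> iter f" "cd f" "cd g"
     "iter g \<bullet> \<langle>p \<bullet> Fst (cd f) Nat, Snd (cd f) Nat\<rangle>" g "\<langle>a, n\<rangle>"] assms
  by simp

lemma iter_id [simp]:
  assumes "wt a" "cd a = A" "wt n" "cd n = Nat" "dm a = dm n"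
  shows "iter (Id A) \<bullet> \<langle>a, n\<rangle> = nf a"
proof -
  have "Obj T A" using assms wt_Obj by metis
  then show ?thesis
    using freyd_unique_comp[of "iter (Id A)" A A "Fst A Nat" "Id A" "\<langle>a, n\<rangle>"] assms by simp
qed

text \<open>
  By \<open>iter_comm\<close>, the last \<open>g\<close> of \<open>n + 1\<close> iterations meets the first \<open>f\<close> and cancels, so
  that the left-hand side has the same value at \<open>n + 1\<close> as at \<open>n\<close>. Only \<open>n\<close> varies in this argument,
  as Freyd's scheme requires.
\<close>
lemma iter_section:
  assumes "wt f" "dm f = A" "cd f = A" "wt g" "dm g = A" "cd g = A"
    and c: "\<And>x. wt x \<Longrightarrow> cd x = A \<Longrightarrow> f \<bullet> g \<bullet> x = nf x"
    and "wt a" "cd a = A" "wt n" "cd n = Nat" "dm a = dm n"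
  shows "iter f \<bullet> \<langle>iter g \<bullet> \<langle>a, n\<rangle>, n\<rangle> = nf a"
proof -
  have "Obj T A" using assms wt_Obj by metis
  then show ?thesis
    using freyd_unique_comp[of "iter f \<bullet> \<langle>iter g, Snd A Nat\<rangle>" A A "Fst A Nat" "Id A" "\<langle>a, n\<rangle>"] assms
    by (simp add: iter_comm[symmetric])
qed

lemma zero_add [simp]:
  assumes "wt n" "cd n = Nat" "dm n = D"
  shows "iter Succ \<bullet> \<langle>Zero \<bullet> Bang D, n\<rangle> = nf n"
proof -
  have o: "Obj T D" using assms wt_Obj by metis
  show ?thesis
    using freyd_unique_comp[of "iter Succ \<bullet> \<langle>Zero \<bullet> Bang (Prod D Nat), Snd D Nat\<rangle>" D Nat "Snd D Nat" Succ "\<langle>Id D, n\<rangle>"] assms o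
    by simp
qed

lemma succ_add [simp]:
  assumes "wt m" "wt n" "cd m = Nat" "cd n = Nat" "dm m = dm n"
  shows "iter Succ \<bullet> \<langle>Succ \<bullet> m, n\<rangle> = Succ \<bullet> iter Succ \<bullet> \<langle>m, n\<rangle>"
  using assms by (simp add: iter_comm)

lemma add_commute:
  assumes "wt m" "wt n" "cd m = Nat" "cd n = Nat" "dm m = dm n"
  shows "iter Succ \<bullet> \<langle>m, n\<rangle> = iter Succ \<bullet> \<langle>n, m\<rangle>"
  using freyd_unique_comp[of "iter Succ" Nat Nat "iter Succ \<bullet> \<langle>Snd Nat Nat, Fst Nat Nat\<rangle>" Succ "\<langle>m, n\<rangle>"] assms by simp

section \<open>Arithmetic and definition by cases\<close>

lemma wt_arith [simp]:
  "wt pred_map" "dm pred_map = Nat" "cd pred_map = Nat"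
  "wt not_map" "dm not_map = Nat" "cd not_map = Nat"
  "wt less_two" "dm less_two = Nat" "cd less_two = Nat"
  "wt add_map" "dm add_map = Prod Nat Nat" "cd add_map = Nat"
  "wt triangle_map" "dm triangle_map = Nat" "cd triangle_map = Nat"
  "wt cantor_map" "dm cantor_map = Prod Nat Nat" "cd cantor_map = Nat"
  by (simp_all add: pred_map_def not_map_def less_two_def add_map_def triangle_map_def
      cantor_map_def zero_of_def true_of_def)

lemma comp_nf_cong:
  assumes "nf f = nf g" shows "f \<bullet> x = g \<bullet> x"
  by (metis assms nf_absorb(2))

lemma pred_zero [simp]:
  assumes "Obj T D" shows "pred_map \<bullet> Zero \<bullet> Bang D = Zero \<bullet> Bang D"
  using assms unfolding nf_absorb(2)[of pred_map, symmetric]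
  by (simp add: pred_map_def nf_syntax zero_of_def)

lemma pred_succ [simp]:
  assumes "wt n" "cd n = Nat" shows "pred_map \<bullet> Succ \<bullet> n = nf n"
proof -
  let ?s = "\<langle>Succ \<bullet> Fst Nat Nat, Fst Nat Nat\<rangle>" and ?z = "Zero \<bullet> Bang (dm n)"
  have "pred_map \<bullet> Succ \<bullet> n = Fst Nat Nat \<bullet> iter ?s \<bullet> \<langle>\<langle>?z, ?z\<rangle>, n\<rangle>"
    using assms unfolding nf_absorb(2)[of pred_map, symmetric]
    by (simp add: pred_map_def nf_syntax zero_of_def)
  also have "\<dots> = iter Succ \<bullet> \<langle>Fst Nat Nat \<bullet> \<langle>?z, ?z\<rangle>, n\<rangle>"
    using assms by (intro iter_natural) simp_all
  also have "\<dots> = nf n" using assms by simp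
  finally show ?thesis .
qed

lemma not_zero [simp]:
  assumes "Obj T D" shows "not_map \<bullet> Zero \<bullet> Bang D = Succ \<bullet> Zero \<bullet> Bang D"
  using assms unfolding nf_absorb(2)[of not_map, symmetric]
  by (simp add: not_map_def nf_syntax true_of_def zero_of_def)

lemma not_succ [simp]:
  assumes "wt n" "cd n = Nat" "dm n = D" shows "not_map \<bullet> Succ \<bullet> n = Zero \<bullet> Bang D"
  using assms unfolding nf_absorb(2)[of not_map, symmetric]
  by (auto simp add: not_map_def nf_syntax true_of_def zero_of_def)

lemma less_two_comp [simp]:
  assumes "wt n" "cd n = Nat" shows "less_two \<bullet> n = not_map \<bullet> pred_map \<bullet> n"
  using assms unfolding nf_absorb(2)[of less_two, symmetric]
  by (simp add: less_two_def nf_syntax)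

text \<open>
  \<open>((a, b), 0) \<mapsto> a\<close> and \<open>((a, b), n + 1) \<mapsto> b\<close>: the first component of the iterate of \<open>(a, b) \<mapsto> (b, b)\<close>.
\<close>
definition cond :: "obj \<Rightarrow> mor" where
  "cond A = Fst A A \<bullet> iter \<langle>Snd A A, Snd A A\<rangle>"

lemma wt_cond [simp]: "wt (cond A) \<longleftrightarrow> Obj T A" "dm (cond A) = Prod (Prod A A) Nat" "cd (cond A) = A"
  by (simp_all add: cond_def)

lemma cond_zero [simp]:
  assumes "wt a" "wt b" "cd a = A" "cd b = A" "dm a = D" "dm b = D"
  shows "cond A \<bullet> \<langle>\<langle>a, b\<rangle>, Zero \<bullet> Bang D\<rangle> = nf a"
proof -
  have "Obj T A" "Obj T D" using assms wt_Obj by metis+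
  then show ?thesis using assms by (simp add: cond_def)
qed

lemma cond_succ [simp]:
  assumes "wt a" "wt b" "wt n" "cd a = A" "cd b = A" "cd n = Nat" "dm a = dm n" "dm b = dm n"
  shows "cond A \<bullet> \<langle>\<langle>a, b\<rangle>, Succ \<bullet> n\<rangle> = nf b"
proof -
  have o: "Obj T A" using assms wt_Obj by metis
  have "Snd A A \<bullet> iter \<langle>Snd A A, Snd A A\<rangle> \<bullet> \<langle>\<langle>a, b\<rangle>, n\<rangle> = iter (Id A) \<bullet> \<langle>Snd A A \<bullet> \<langle>a, b\<rangle>, n\<rangle>"
    using assms o by (intro iter_natural) simp_all
  then show ?thesis using assms o by (simp add: cond_def)
qed

lemma cond_natural:
  assumes "wt p" "dm p = A" "cd p = B"
    "wt a" "wt b" "wt n" "cd a = A" "cd b = A" "cd n = Nat" "dm a = dm n" "dm b = dm n"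
  shows "p \<bullet> cond A \<bullet> \<langle>\<langle>a, b\<rangle>, n\<rangle> = cond B \<bullet> \<langle>\<langle>p \<bullet> a, p \<bullet> b\<rangle>, n\<rangle>"
proof -
  let ?P = "Prod A A"
  have o: "Obj T A" "Obj T B" using assms wt_Obj by metis+
  have "nf (p \<bullet> cond A) = nf (cond B \<bullet> \<langle>\<langle>p \<bullet> Fst A A \<bullet> Fst ?P Nat, p \<bullet> Snd A A \<bullet> Fst ?P Nat\<rangle>, Snd ?P Nat\<rangle>)"
    using assms o cond_zero[of "Fst A A" "Snd A A" A ?P]
      cond_succ[of "Fst A A \<bullet> Fst ?P Nat" "Snd A A \<bullet> Fst ?P Nat" "Snd ?P Nat" A]
    by (intro case_unique[where A="?P" and B=B]) simp_all
  then have "(p \<bullet> cond A) \<bullet> \<langle>\<langle>a, b\<rangle>, n\<rangle>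
     = (cond B \<bullet> \<langle>\<langle>p \<bullet> Fst A A \<bullet> Fst ?P Nat, p \<bullet> Snd A A \<bullet> Fst ?P Nat\<rangle>, Snd ?P Nat\<rangle>) \<bullet> \<langle>\<langle>a, b\<rangle>, n\<rangle>"
    by (rule comp_nf_cong)
  then show ?thesis using assms o by simp
qed

section \<open>Decoding Cantor's pairing\<close>

text \<open>
  The successor of a pair in Cantor's enumeration, for the pair \<open>(a, b)\<close> given as \<open>(a, a + b)\<close>:
  \<open>(0, d) \<mapsto> (d + 1, d + 1)\<close> starts the next diagonal, \<open>(a + 1, d) \<mapsto> (a, d)\<close> advances within one.
\<close>
definition walk :: mor where
  "walk = cond (Prod Nat Nat) \<bullet>
     \<langle>\<langle>\<langle>Succ \<bullet> Snd Nat Nat, Succ \<bullet> Snd Nat Nat\<rangle>, \<langle>pred_map \<bullet> Fst Nat Nat, Snd Nat Nat\<rangle>\<rangle>, Fst Nat Nat\<rangle>"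

lemma wt_walk [simp]: "wt walk" "dm walk = Prod Nat Nat" "cd walk = Prod Nat Nat"
  by (simp_all add: walk_def)

lemma walk_zero [simp]:
  assumes "wt d" "cd d = Nat" "dm d = D"
  shows "walk \<bullet> \<langle>Zero \<bullet> Bang D, d\<rangle> = \<langle>Succ \<bullet> d, Succ \<bullet> d\<rangle>"
proof -
  have "Obj T D" using assms wt_Obj by metis
  then show ?thesis using assms by (simp add: walk_def)
qed

lemma walk_succ [simp]:
  assumes "wt a" "cd a = Nat" "wt d" "cd d = Nat" "dm a = dm d"
  shows "walk \<bullet> \<langle>Succ \<bullet> a, d\<rangle> = \<langle>a, d\<rangle>"
  using assms by (simp add: walk_def)

text \<open>
  \<open>walk\<close> is a left inverse of \<open>(a, d) \<mapsto> (a + 1, d)\<close>, whose \<open>b\<close>-fold iterate sends \<open>(a, d)\<close> to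
  \<open>(a + b, d)\<close>.
\<close>
lemma walk_down:
  assumes "wt a" "wt b" "wt d" "cd a = Nat" "cd b = Nat" "cd d = Nat" "dm a = dm b" "dm d = dm b"
  shows "iter walk \<bullet> \<langle>\<langle>iter Succ \<bullet> \<langle>a, b\<rangle>, d\<rangle>, b\<rangle> = \<langle>a, d\<rangle>"
proof -
  let ?up = "\<langle>Succ \<bullet> Fst Nat Nat, Snd Nat Nat\<rangle>" and ?P = "Prod Nat Nat"
  have up: "iter ?up \<bullet> \<langle>\<langle>a, d\<rangle>, b\<rangle> = \<langle>iter Succ \<bullet> \<langle>a, b\<rangle>, d\<rangle>"
    using freyd_unique_comp[of "iter ?up" ?P ?P
      "\<langle>iter Succ \<bullet> \<langle>Fst Nat Nat \<bullet> Fst ?P Nat, Snd ?P Nat\<rangle>, Snd Nat Nat \<bullet> Fst ?P Nat\<rangle>" ?up "\<langle>\<langle>a, d\<rangle>, b\<rangle>"] assms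
    by simp
  have "iter walk \<bullet> \<langle>iter ?up \<bullet> \<langle>\<langle>a, d\<rangle>, b\<rangle>, b\<rangle> = nf \<langle>a, d\<rangle>"
    using assms by (intro iter_section) simp_all
  then show ?thesis by (simp add: up)
qed

lemma add_map_comp [simp]: "add_map \<bullet> x = iter Succ \<bullet> x"
  by (rule comp_nf_cong) (simp add: add_map_def nf_syntax)

lemma triangle_zero [simp]:
  assumes "Obj T D" shows "triangle_map \<bullet> Zero \<bullet> Bang D = Zero \<bullet> Bang D"
  using assms unfolding nf_absorb(2)[of triangle_map, symmetric]
  by (simp add: triangle_map_def nf_syntax zero_of_def)

lemma triangle_succ [simp]:
  assumes "wt n" "cd n = Nat"
  shows "triangle_map \<bullet> Succ \<bullet> n = iter Succ \<bullet> \<langle>triangle_map \<bullet> n, Succ \<bullet> n\<rangle>"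
proof -
  let ?s = "\<langle>Succ \<bullet> Fst Nat Nat, iter Succ \<bullet> \<langle>Snd Nat Nat, Succ \<bullet> Fst Nat Nat\<rangle>\<rangle>" and ?z = "Zero \<bullet> Bang (dm n)"
  have t: "triangle_map \<bullet> k = Snd Nat Nat \<bullet> iter ?s \<bullet> \<langle>\<langle>Zero \<bullet> Bang (dm k), Zero \<bullet> Bang (dm k)\<rangle>, k\<rangle>"
    if "wt k" "cd k = Nat" for k
    using that unfolding nf_absorb(2)[of triangle_map, symmetric]
    by (simp add: triangle_map_def nf_syntax zero_of_def)
  have "Fst Nat Nat \<bullet> iter ?s \<bullet> \<langle>\<langle>?z, ?z\<rangle>, n\<rangle> = iter Succ \<bullet> \<langle>Fst Nat Nat \<bullet> \<langle>?z, ?z\<rangle>, n\<rangle>"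
    using assms by (intro iter_natural) simp_all
  then show ?thesis using assms by (simp add: t)
qed

definition decode_diag :: mor where
  "decode_diag = iter walk \<bullet> \<langle>\<langle>Zero \<bullet> Bang Nat, Zero \<bullet> Bang Nat\<rangle>, Id Nat\<rangle>"

lemma wt_decode_diag [simp]: "wt decode_diag" "dm decode_diag = Nat" "cd decode_diag = Prod Nat Nat"
  by (simp_all add: decode_diag_def)

lemma walk_down_0:
  assumes "wt d" "cd d = Nat" "wt b" "cd b = Nat" "dm d = dm b"
  shows "iter walk \<bullet> \<langle>\<langle>b, d\<rangle>, b\<rangle> = \<langle>Zero \<bullet> Bang (dm b), d\<rangle>"
  using walk_down[of "Zero \<bullet> Bang (dm b)" b d] assms by simp

text \<open>
  Induction on \<open>n\<close>: the \<open>n + 1\<close> steps from triangular number \<open>n\<close> to triangular number \<open>n + 1\<close> lead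
  from \<open>(n, n)\<close> down to \<open>(0, n)\<close> and on to \<open>(n + 1, n + 1)\<close>. Since this number of steps depends
  on \<open>n\<close>, the recursion has a step with parameter.
\<close>
lemma decode_triangle:
  assumes "wt n" "cd n = Nat"
  shows "decode_diag \<bullet> triangle_map \<bullet> n = \<langle>n, n\<rangle>"
proof -
  let ?N = "Prod One Nat" and ?P = "Prod Nat Nat"
  have "nf (decode_diag \<bullet> triangle_map \<bullet> Snd One Nat) = nf \<langle>Snd One Nat, Snd One Nat\<rangle>"
    by (intro prim_rec_unique[where A=One and B="?P" and
          g="iter walk \<bullet> \<langle>Snd ?N ?P, Succ \<bullet> Snd One Nat \<bullet> Fst ?N ?P\<rangle>"])
       (simp_all add: decode_diag_def walk_down_0)
  then have "(decode_diag \<bullet> triangle_map \<bullet> Snd One Nat) \<bullet> \<langle>Bang (dm n), n\<rangle> = \<langle>Snd One Nat, Snd One Nat\<rangle> \<bullet> \<langle>Bang (dm n), n\<rangle>"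
    by (rule comp_nf_cong)
  then show ?thesis using assms by simp
qed

lemma cantor_comp [simp]:
  assumes "wt a" "wt b" "cd a = Nat" "cd b = Nat" "dm a = dm b"
  shows "cantor_map \<bullet> \<langle>a, b\<rangle> = iter Succ \<bullet> \<langle>triangle_map \<bullet> iter Succ \<bullet> \<langle>a, b\<rangle>, b\<rangle>"
  using assms unfolding nf_absorb(2)[of cantor_map, symmetric]
  by (simp add: cantor_map_def nf_syntax)

lemma decode_cantor:
  assumes "wt a" "wt b" "cd a = Nat" "cd b = Nat" "dm a = dm b"
  shows "decode_diag \<bullet> cantor_map \<bullet> \<langle>a, b\<rangle> = \<langle>a, iter Succ \<bullet> \<langle>a, b\<rangle>\<rangle>"
proof -
  let ?z = "Zero \<bullet> Bang (dm b)" and ?s = "iter Succ \<bullet> \<langle>a, b\<rangle>"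
  have "decode_diag \<bullet> cantor_map \<bullet> \<langle>a, b\<rangle> = iter walk \<bullet> \<langle>iter walk \<bullet> \<langle>\<langle>?z, ?z\<rangle>, triangle_map \<bullet> ?s\<rangle>, b\<rangle>"
    using assms by (simp add: decode_diag_def)
  also have "iter walk \<bullet> \<langle>\<langle>?z, ?z\<rangle>, triangle_map \<bullet> ?s\<rangle> = decode_diag \<bullet> triangle_map \<bullet> ?s"
    using assms by (simp add: decode_diag_def)
  also have "\<dots> = \<langle>?s, ?s\<rangle>" using assms by (intro decode_triangle) simp_all
  also have "iter walk \<bullet> \<langle>\<langle>?s, ?s\<rangle>, b\<rangle> = \<langle>a, ?s\<rangle>" using assms by (intro walk_down) simp_all
  finally show ?thesis .
qed

text \<open>
  The second component \<open>b\<close> is recovered from \<open>(a, a + b)\<close> as \<open>(a + b) - a\<close>.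
\<close>
definition decode_left :: mor where "decode_left = Fst Nat Nat \<bullet> decode_diag"
definition decode_right :: mor where "decode_right = iter pred_map \<bullet> \<langle>Snd Nat Nat \<bullet> decode_diag, decode_left\<rangle>"

lemma wt_decode [simp]: "wt decode_left" "dm decode_left = Nat" "cd decode_left = Nat"
  "wt decode_right" "dm decode_right = Nat" "cd decode_right = Nat"
  by (simp_all add: decode_left_def decode_right_def)

lemma decode_left_cantor:
  assumes "wt a" "wt b" "cd a = Nat" "cd b = Nat" "dm a = dm b"
  shows "decode_left \<bullet> cantor_map \<bullet> \<langle>a, b\<rangle> = nf a"
  using assms by (simp add: decode_left_def decode_cantor del: cantor_comp)

lemma decode_right_cantor:
  assumes "wt a" "wt b" "cd a = Nat" "cd b = Nat" "dm a = dm b"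
  shows "decode_right \<bullet> cantor_map \<bullet> \<langle>a, b\<rangle> = nf b"
proof -
  have "decode_right \<bullet> cantor_map \<bullet> \<langle>a, b\<rangle> = iter pred_map \<bullet> \<langle>iter Succ \<bullet> \<langle>b, a\<rangle>, a\<rangle>"
    using assms by (simp add: decode_right_def decode_cantor decode_left_cantor add_commute[of a b] del: cantor_comp)
  also have "\<dots> = nf b" using assms by (intro iter_section) simp_all
  finally show ?thesis .
qed

section \<open>Constructions of retraction pairs\<close>

lemma retraction_pair_iff:
  "retraction_pair T A B f g \<longleftrightarrow>
     wt f \<and> dm f = A \<and> cd f = B \<and> wt g \<and> dm g = B \<and> cd g = A \<and> g \<bullet> f = nf (Id A)"
  by (auto simp: retraction_pair_def Eqn_iff Map_iff nf_Comp)

lemma retraction_pairI: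
  assumes "wt f" "dm f = A" "cd f = B" "wt g" "dm g = B" "cd g = A" "nf g \<bullet> nf f = nf (Id A)"
  shows "retraction_pair T A B f g"
  using assms by (simp add: retraction_pair_iff)

lemma retraction_pairD:
  assumes "retraction_pair T A B f g"
  shows "wt f" "dm f = A" "cd f = B" "wt g" "dm g = B" "cd g = A" "Obj T A" "Obj T B"
    and "\<And>x. wt x \<Longrightarrow> cd x = A \<Longrightarrow> g \<bullet> f \<bullet> x = nf x" and "g \<bullet> f = nf (Id A)"
proof -
  show *: "wt f" "dm f = A" "cd f = B" "wt g" "dm g = B" "cd g = A" and e: "g \<bullet> f = nf (Id A)"
    using assms by (simp_all add: retraction_pair_iff)
  then show "Obj T A" "Obj T B" using wt_Obj by metis+
  show "g \<bullet> f \<bullet> x = nf x" if x: "wt x" "cd x = A" for x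
  proof -
    have "g \<bullet> f \<bullet> x = (g \<bullet> f) \<bullet> x" using * that by (intro comp_assoc[symmetric]) simp_all
    also have "\<dots> = Id A \<bullet> x" unfolding e by simp
    finally show ?thesis using x by simp
  qed
qed

lemma retraction_pair_Comp:
  assumes "retraction_pair T A B f g" "retraction_pair T B C f' g'"
  shows "retraction_pair T A C (f' \<cdot> f) (g \<cdot> g')"
  using retraction_pairD[OF assms(1)] retraction_pairD[OF assms(2)]
  by (intro retraction_pairI) (simp_all add: nf_syntax)

lemma retraction_pair_cross:
  assumes "retraction_pair T A A' f g" "retraction_pair T B B' f' g'"
  shows "retraction_pair T (Prod A B) (Prod A' B') (cross A B f f') (cross A' B' g g')"
  using retraction_pairD[OF assms(1)] retraction_pairD[OF assms(2)]
  by (intro retraction_pairI) (simp_all add: cross_def nf_syntax)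

lemma retraction_pair_One: "retraction_pair T One Nat Zero (Bang Nat)"
  using nf_terminal[of "Id One"] by (intro retraction_pairI) (simp_all add: nf_syntax)

lemma pred_eq_cond:
  assumes "wt n" "cd n = Nat" "dm n = D"
  shows "cond Nat \<bullet> \<langle>\<langle>Succ \<bullet> Zero \<bullet> Bang D, n\<rangle>, n\<rangle> = Succ \<bullet> pred_map \<bullet> n"
proof -
  have o: "Obj T D" using assms wt_Obj by metis
  let ?k = "Snd One Nat"
  have "nf (cond Nat \<bullet> \<langle>\<langle>Succ \<bullet> Zero \<bullet> Bang (Prod One Nat), ?k\<rangle>, ?k\<rangle>) = nf (Succ \<bullet> pred_map \<bullet> ?k)"
    by (intro case_unique[where A=One and B=Nat]) simp_all
  then have "(cond Nat \<bullet> \<langle>\<langle>Succ \<bullet> Zero \<bullet> Bang (Prod One Nat), ?k\<rangle>, ?k\<rangle>) \<bullet> \<langle>Bang D, n\<rangle>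
     = (Succ \<bullet> pred_map \<bullet> ?k) \<bullet> \<langle>Bang D, n\<rangle>"
    by (rule comp_nf_cong)
  then show ?thesis using assms o by simp
qed

text \<open>
  The free-variable calculus has no implication, so this is derived from an unconditional equation:
  the map that takes \<open>n\<close> to \<open>0\<close> if \<open>not n = 0\<close>, and to \<open>n\<close> otherwise, is constantly \<open>0\<close>. If
  \<open>not n = 1\<close> is provable, its value is also \<open>n\<close>.
\<close>
lemma zero_of_not:
  assumes "wt n" "cd n = Nat" "dm n = D" and t: "not_map \<bullet> n = Succ \<bullet> Zero \<bullet> Bang D"
  shows "nf n = Zero \<bullet> Bang D"
proof -
  have o: "Obj T D" using assms wt_Obj by metis
  let ?k = "Snd One Nat" and ?z = "Zero \<bullet> Bang (Prod One Nat)"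
  have "nf (cond Nat \<bullet> \<langle>\<langle>?z, ?k\<rangle>, not_map \<bullet> ?k\<rangle>) = nf ?z"
    by (intro case_unique[where A=One and B=Nat]) simp_all
  then have "(cond Nat \<bullet> \<langle>\<langle>?z, ?k\<rangle>, not_map \<bullet> ?k\<rangle>) \<bullet> \<langle>Bang D, n\<rangle> = ?z \<bullet> \<langle>Bang D, n\<rangle>"
    by (rule comp_nf_cong)
  then show ?thesis using assms o by simp
qed

text \<open>
  The retraction is \<open>r a = (if \<chi> a = 0 then p else a)\<close> for the point \<open>p\<close>. It takes values in the
  extension: \<open>\<chi> (r a)\<close> is \<open>1\<close> if \<open>\<chi> a = 0\<close> and \<open>\<chi> a\<close> otherwise, which is the successor of the
  predecessor of \<open>\<chi> a\<close>, and this predecessor is \<open>0\<close> because \<open>\<chi> a < 2\<close>.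
\<close>
lemma retraction_Sub:
  assumes o: "Obj T (Sub A \<chi>)" and p: "Map T One (Sub A \<chi>) p"
  shows "\<exists>g. retraction_pair T (Sub A \<chi>) A (Incl A \<chi>) g"
proof -
  note d = Obj_SubD[OF o]
  have p: "wt p" "dm p = One" "cd p = Sub A \<chi>" using p by (simp_all add: Map_iff)
  let ?q = "Incl A \<chi> \<bullet> p \<bullet> Bang A"
  let ?r = "cond A \<bullet> \<langle>\<langle>?q, Id A\<rangle>, \<chi>\<rangle>"
  have "nf (less_two \<cdot> \<chi>) = nf (true_of A)"
    using o by (simp add: Obj_Sub_iff Eqn_iff)
  then have "not_map \<bullet> pred_map \<bullet> \<chi> = Succ \<bullet> Zero \<bullet> Bang A"
    using d by (simp add: nf_syntax true_of_def)
  then have pz: "pred_map \<bullet> \<chi> = Zero \<bullet> Bang A"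
    using zero_of_not[of "pred_map \<bullet> \<chi>" A] d by simp
  have q: "\<chi> \<bullet> ?q = Succ \<bullet> Zero \<bullet> Bang A"
    using true_comp[of A \<chi> "Incl A \<chi>" "p \<bullet> Bang A"] o d p by simp
  have "\<chi> \<bullet> ?r = cond Nat \<bullet> \<langle>\<langle>\<chi> \<bullet> ?q, \<chi> \<bullet> Id A\<rangle>, \<chi>\<rangle>"
    using o d p by (intro cond_natural) simp_all
  also have "\<dots> = Succ \<bullet> Zero \<bullet> Bang A"
    using d by (simp add: q pred_eq_cond pz)
  finally have "wt (lift A \<chi> ?r)" using o d p by simp
  moreover have "lift A \<chi> ?r \<bullet> Incl A \<chi> = nf (Id (Sub A \<chi>))"
    using calculation o d p lift_incl[of "Id (Sub A \<chi>)" A \<chi>] by simp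
  ultimately have "retraction_pair T (Sub A \<chi>) A (Incl A \<chi>) (lift A \<chi> ?r)"
    using o d p by (simp add: retraction_pair_iff)
  then show ?thesis ..
qed

lemma is_code_comp [simp]:
  assumes "wt f" "cd f = Nat" shows "is_code \<bullet> f = Succ \<bullet> Zero \<bullet> Bang (dm f)"
  using assms unfolding nf_absorb(2)[of is_code, symmetric]
  by (simp add: is_code_def true_of_def nf_syntax)

lemma Obj_X [simp]: "Obj T X"
  by (simp add: X_def Obj_Sub_iff Eqn_iff Map_iff is_code_def true_of_def nf_syntax)

lemma Obj_X' [simp]: "Obj T (Sub Nat is_code)"
  using Obj_X by (simp add: X_def)

lemma nf_code_single: "nf code_single = lift Nat is_code (cantor_map \<bullet> \<langle>Zero \<bullet> Bang Nat, Id Nat\<rangle>)"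
  by (simp add: code_single_def zero_of_def nf_syntax wt_Lift del: cantor_comp)

lemma nf_code_pair: "nf code_pair = lift Nat is_code (cantor_map \<bullet> \<langle>Succ \<bullet> Incl Nat is_code \<bullet> Fst X X, Incl Nat is_code \<bullet> Snd X X\<rangle>)"
  by (simp add: code_pair_def cross_def X_def nf_syntax wt_Lift del: cantor_comp)

lemma wt_code [simp]:
  "wt code_single" "dm code_single = Nat" "cd code_single = X"
  "wt code_pair" "dm code_pair = Prod X X" "cd code_pair = X"
  by (simp_all add: code_single_def code_pair_def zero_of_def cross_def X_def wt_Lift del: cantor_comp)

lemma retraction_pair_code_single:
  "retraction_pair T Nat X code_single (decode_right \<bullet> Incl Nat is_code)"
proof -
  have "(decode_right \<bullet> Incl Nat is_code) \<bullet> nf code_single = nf (Id Nat)"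
    unfolding nf_code_single by (simp add: decode_right_cantor del: cantor_comp)
  then show ?thesis by (simp add: retraction_pair_iff X_def)
qed

text \<open>
  The first component is shifted by one in codes of pairs, hence the predecessor.
\<close>
lemma retraction_pair_code_pair:
  "retraction_pair T (Prod X X) X code_pair
     \<langle>lift Nat is_code (pred_map \<bullet> decode_left \<bullet> Incl Nat is_code),
      lift Nat is_code (decode_right \<bullet> Incl Nat is_code)\<rangle>"
  (is "retraction_pair T _ _ _ ?r")
proof -
  have "?r \<bullet> nf code_pair = nf (Id (Prod X X))"
    unfolding nf_code_pair using pair_id[of X X]
    by (simp add: decode_right_cantor decode_left_cantor X_def del: cantor_comp)
  then show ?thesis by (simp add: retraction_pair_iff) (simp add: X_def)
qed

lemma nf_precomp:
  assumes "Obj T (Exp A C)" "Obj T (Exp A B)" "has_eps T C A" "has_eps T B A" "wt g" "dm g = B" "cd g = C"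
  shows "wt (precomp A B C g)" "dm (precomp A B C g) = Exp A C" "cd (precomp A B C g) = Exp A B"
    "nf (precomp A B C g) = conj (Eps C A \<bullet> \<langle>Fst (Exp A C) B, g \<bullet> Snd (Exp A C) B\<rangle>)"
proof -
  have "Obj T B" "Obj T C" "Obj T A" using assms by (simp_all add: Obj_Exp_iff)
  then show "wt (precomp A B C g)" "dm (precomp A B C g) = Exp A C" "cd (precomp A B C g) = Exp A B"
    "nf (precomp A B C g) = conj (Eps C A \<bullet> \<langle>Fst (Exp A C) B, g \<bullet> Snd (Exp A C) B\<rangle>)"
    using assms by (simp_all add: precomp_def cross_def nf_syntax)
qed

lemma eval_precomp:
  assumes "Obj T (Exp A C)" "Obj T (Exp A B)" "has_eps T C A" "has_eps T B A" "wt g" "dm g = B" "cd g = C"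
    "wt F" "cd F = Exp A C" "wt b" "cd b = B" "dm F = dm b"
  shows "Eps B A \<bullet> \<langle>precomp A B C g \<bullet> F, b\<rangle> = Eps C A \<bullet> \<langle>F, g \<bullet> b\<rangle>"
proof -
  have o: "Obj T B" "Obj T C" "Obj T A" using assms by (simp_all add: Obj_Exp_iff)
  have "Eps B A \<bullet> \<langle>nf (precomp A B C g) \<bullet> F, b\<rangle> = Eps C A \<bullet> \<langle>F, g \<bullet> b\<rangle>"
    unfolding nf_precomp(4)[OF assms(1-7)] using assms o by simp
  then show ?thesis by simp
qed

lemma nf_pow_map:
  assumes "Obj T (Exp B A)" "Obj T (Exp C A)" "has_eps T A B" "has_eps T A C" "wt g" "dm g = B" "cd g = C"
  shows "wt (pow_map A B g)" "dm (pow_map A B g) = Exp B A" "cd (pow_map A B g) = Exp C A"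
    "nf (pow_map A B g) = conj (g \<bullet> Eps A B)"
  using assms by (simp_all add: pow_map_def nf_syntax)

lemma eval_pow_map:
  assumes "Obj T (Exp B A)" "Obj T (Exp C A)" "has_eps T A B" "has_eps T A C" "wt g" "dm g = B" "cd g = C"
    "wt F" "cd F = Exp B A" "wt a" "cd a = A" "dm F = dm a"
  shows "Eps A C \<bullet> \<langle>pow_map A B g \<bullet> F, a\<rangle> = g \<bullet> Eps A B \<bullet> \<langle>F, a\<rangle>"
proof -
  have "Eps A C \<bullet> \<langle>nf (pow_map A B g) \<bullet> F, a\<rangle> = g \<bullet> Eps A B \<bullet> \<langle>F, a\<rangle>"
    unfolding nf_pow_map(4)[OF assms(1-7)] using assms by simp
  then show ?thesis by simp
qed

text \<open>
  Extensionality: maps into \<open>C^B\<close> are determined by their coconjugates.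
\<close>
lemma exp_eqI:
  assumes "wt F" "wt G" "cd F = Exp C B" "cd G = Exp C B" "has_eps T B C" "dm F = D" "dm G = D"
    "Eps B C \<bullet> \<langle>F \<bullet> Fst D B, Snd D B\<rangle> = Eps B C \<bullet> \<langle>G \<bullet> Fst D B, Snd D B\<rangle>"
  shows "nf F = nf G"
  using conj_eps[of F C B D] conj_eps[of G C B D] assms by simp

text \<open>
  Precomposition is contravariant: a retraction \<open>g\<close> of \<open>C\<close> onto \<open>B\<close> induces the embedding of \<open>A^B\<close> in
  \<open>A^C\<close>, and the section \<open>f\<close> its retraction.
\<close>
lemma retraction_pair_precomp:
  assumes "retraction_pair T B C f g" "Obj T (Exp A B)" "Obj T (Exp A C)" "has_eps T B A" "has_eps T C A"
  shows "retraction_pair T (Exp A B) (Exp A C) (precomp A C B g) (precomp A B C f)"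
proof -
  note r = retraction_pairD[OF assms(1)]
  note n = nf_precomp(1-3)
  have o: "Obj T A" using assms(2) by (simp add: Obj_Exp_iff)
  have "nf (precomp A B C f \<bullet> precomp A C B g) = nf (Id (Exp A B))"
    using r assms(2-) o by (intro exp_eqI[of _ _ A B "Exp A B"]) (simp_all add: n eval_precomp)
  then show ?thesis using r assms by (intro retraction_pairI) (simp_all add: n)
qed

lemma retraction_pair_pow_map:
  assumes "retraction_pair T B C f g" "Obj T (Exp B A)" "Obj T (Exp C A)" "has_eps T A B" "has_eps T A C"
  shows "retraction_pair T (Exp B A) (Exp C A) (pow_map A B f) (pow_map A C g)"
proof -
  note r = retraction_pairD[OF assms(1)]
  note n = nf_pow_map(1-3)
  have o: "Obj T A" using assms(2) by (simp add: Obj_Exp_iff)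
  have "nf (pow_map A C g \<bullet> pow_map A B f) = nf (Id (Exp B A))"
    using r assms(2-) o by (intro exp_eqI[of _ _ B A "Exp B A"])
      (simp_all add: n[where B=B and C=C] n[where B=C and C=B]
        eval_pow_map[where B=B and C=C] eval_pow_map[where B=C and C=B])
  then show ?thesis using r assms by (intro retraction_pairI) (simp_all add: n[where B=B and C=C] n[where B=C and C=B])
qed

text \<open>
  The pairing \<open>q\<close> is applied pointwise, \<open>(F, G) \<mapsto> (a \<mapsto> q (F a, G a))\<close>, and undone by composition with
  the two components of \<open>r\<close>.
\<close>
lemma coretractive_power_square:
  assumes "retraction_pair T (Prod B B) B q r" "Obj T (Exp B A)" "has_eps T A B"
  shows "\<exists>f. coretractive T (Prod (Exp B A) (Exp B A)) (Exp B A) f"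
proof -
  note r = retraction_pairD[OF assms(1)]
  let ?E = "Exp B A"
  let ?P = "Prod ?E ?E"
  have o: "Obj T A" "Obj T B" using assms(2) by (simp_all add: Obj_Exp_iff)
  let ?f = "conj (q \<bullet> \<langle>Eps A B \<bullet> \<langle>Fst ?E ?E \<bullet> Fst ?P A, Snd ?P A\<rangle>, Eps A B \<bullet> \<langle>Snd ?E ?E \<bullet> Fst ?P A, Snd ?P A\<rangle>\<rangle>)"
  let ?g = "\<langle>pow_map A B (Fst B B \<bullet> r), pow_map A B (Snd B B \<bullet> r)\<rangle>"
  note n = nf_pow_map(1-3)[where B=B and C=B] eval_pow_map[where B=B and C=B]
  have "nf (pow_map A B (Fst B B \<bullet> r) \<bullet> ?f) = nf (Fst ?E ?E)"
    using r assms(2-) o by (intro exp_eqI[of _ _ B A ?P]) (simp_all add: n)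
  moreover have "nf (pow_map A B (Snd B B \<bullet> r) \<bullet> ?f) = nf (Snd ?E ?E)"
    using r assms(2-) o by (intro exp_eqI[of _ _ B A ?P]) (simp_all add: n)
  moreover have "\<langle>nf (Fst ?E ?E), nf (Snd ?E ?E)\<rangle> = nf (Id ?P)"
    using assms(2) by simp
  ultimately have "retraction_pair T ?P ?E ?f ?g"
    using r assms(2-) o by (intro retraction_pairI) (simp_all add: n)
  then show ?thesis by (auto simp: coretractive_def)
qed

lemma retraction_pair_Iso:
  assumes "Obj T (Exp (Exp C B) A)" "Obj T (Exp C (Prod B A))" "has_iso T A B C"
  shows "retraction_pair T (Exp (Exp C B) A) (Exp C (Prod B A)) (IsoTo A B C) (IsoFrom A B C)"
  using assms by (auto simp: retraction_pair_def intro: map_IsoTo map_IsoFrom iso_from_to)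

text \<open>
  A constant function evaluated anywhere returns its value.
\<close>
lemma retraction_pair_emb_1:
  assumes "Obj T (Exp X X)" "Obj T (Exp X One)" "has_eps T X X" "has_eps T One X"
  shows "retraction_pair T X (U 2) (emb 1) (ret 1)"
proof -
  have s: "U 2 = Exp X X" "emb 1 = precomp X X One (Bang X) \<cdot> Conj (Fst X One)"
    "ret 1 = Eps X X \<cdot> Pair (Id (Exp X X)) (code_single \<cdot> Zero \<cdot> Bang (Exp X X))"
    by (simp_all add: numeral_2_eq_2)
  show ?thesis unfolding s using assms
    by (intro retraction_pairI) (simp_all add: nf_syntax nf_precomp(1-3) eval_precomp)
qed

end

section \<open>Orders and strata\<close>

definition thy_le :: "thy \<Rightarrow> thy \<Rightarrow> bool" where
  "thy_le T T' \<longleftrightarrow> has_exp T \<le> has_exp T' \<and> has_eps T \<le> has_eps T' \<and>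
     has_lam T \<le> has_lam T' \<and> has_iso T \<le> has_iso T'"

lemma thy_mono:
  assumes "thy_le T T'"
  shows "Obj T A \<Longrightarrow> Obj T' A"
    and "Map T A B f \<Longrightarrow> Map T' A B f"
    and "Eqn T A B f g \<Longrightarrow> Eqn T' A B f g"
proof -
  have le: "\<And>B A. has_exp T B A \<Longrightarrow> has_exp T' B A" "\<And>A B. has_eps T A B \<Longrightarrow> has_eps T' A B"
    "\<And>A B. has_lam T A B \<Longrightarrow> has_lam T' A B" "\<And>A B C. has_iso T A B C \<Longrightarrow> has_iso T' A B C"
    using assms by (auto simp: thy_le_def le_fun_def)
  show "Obj T A \<Longrightarrow> Obj T' A" "Map T A B f \<Longrightarrow> Map T' A B f" "Eqn T A B f g \<Longrightarrow> Eqn T' A B f g"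
    by (induction rule: Obj_Map_Eqn.inducts)
      ((rule Obj_Map_Eqn.intros; (assumption | rule le; assumption))+)
qed

lemma retraction_pair_mono:
  "thy_le T T' \<Longrightarrow> retraction_pair T A B f g \<Longrightarrow> retraction_pair T' A B f g"
  unfolding retraction_pair_def using thy_mono by blast

lemma stratum_mono: "n \<le> m \<Longrightarrow> thy_le (PReps_stratum n) (PReps_stratum m)"
  unfolding thy_le_def PReps_stratum_def le_fun_def le_bool_def thy.sel
  by (intro conjI allI impI) (blast intro: order.trans order.strict_trans2)+

lemma stratum_le_PReps: "thy_le (PReps_stratum n) PReps"
  by (auto simp: thy_le_def PReps_stratum_def PReps_def le_fun_def)

inductive_cases order_Prod_elim: "has_order (Prod A B) k"
inductive_cases order_Sub_elim: "has_order (Sub A \<chi>) k"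
inductive_simps order_Exp_iff: "has_order (Exp B A) k"
inductive_cases order_base_elim: "has_order One k" "has_order Nat k"

lemma has_order_pos: "has_order A k \<Longrightarrow> 1 \<le> k"
  by (induction rule: has_order.induct) auto

lemma Obj_Sub_base: "Obj T (Sub A \<chi>) \<Longrightarrow> Obj T A"
  by (rule pr_theory.Obj_SubD)

lemma PRa_order: "Obj PRa A \<Longrightarrow> has_order A 1"
proof (induction A rule: measure_induct_rule[of size])
  case (less A)
  show ?case
  proof (cases A)
    case (Prod B C)
    then show ?thesis using less has_order.intros(3)[of B 1 C 1] by auto
  next
    case (Sub B \<chi>)
    then have "Obj PRa B" using less.prems Obj_Sub_base by simp
    then show ?thesis using less.IH[of B] Sub by (auto intro: has_order.intros(4))
  next
    case (Exp B C)
    then show ?thesis using less.prems by (simp add: Obj_Exp_iff PRa_def)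
  qed (auto intro: has_order.intros(1,2)[simplified])
qed

lemma stratum_has_order: "Obj (PReps_stratum n) A \<Longrightarrow> 1 \<le> n \<Longrightarrow> \<exists>k\<le>n. has_order A k"
proof (induction A rule: measure_induct_rule[of size])
  case (less A)
  show ?case
  proof (cases A)
    case (Prod B C)
    then have "Obj (PReps_stratum n) B" "Obj (PReps_stratum n) C" using less.prems by auto
    then obtain i j where "i \<le> n" "has_order B i" "j \<le> n" "has_order C j"
      using less.IH[of B] less.IH[of C] less.prems Prod by auto
    then show ?thesis using has_order.intros(3)[of B i C j] Prod by (intro exI[of _ "max i j"]) simp
  next
    case (Sub B \<chi>)
    then have "Obj (PReps_stratum n) B" using less.prems Obj_Sub_base by simp
    then obtain i where "i \<le> n" "has_order B i" using less.IH[of B] less.prems Sub by auto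
    then show ?thesis using has_order.intros(4) Sub by blast
  next
    case (Exp B C)
    then show ?thesis using less.prems by (auto simp: Obj_Exp_iff PReps_stratum_def)
  qed (use less.prems(2) in \<open>auto intro!: exI[of _ 1] has_order.intros(1,2)[simplified]\<close>)
qed

lemma X_PRa: "Obj PRa X"
  by (rule pr_theory.Obj_X)

lemma U_order: "has_order (U (Suc k)) (Suc k)"
proof (induction k)
  case 0
  then show ?case using PRa_order[OF X_PRa] by simp
next
  case (Suc k)
  then show ?case using has_order.intros(5)[OF X_PRa Suc] by simp
qed

lemma stratum_exp:
  assumes "Obj (PReps_stratum n) A" "Obj (PReps_stratum n) C" "Obj PRa C" "has_order A i" "i < n"
  shows "Obj (PReps_stratum n) (Exp C A)" "has_eps (PReps_stratum n) A C"
proof -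
  have "has_order (Exp C A) (1 + i)" using assms by (intro has_order.intros)
  then show "Obj (PReps_stratum n) (Exp C A)"
    using assms by (auto simp: Obj_Exp_iff PReps_stratum_def intro!: exI[of _ "Suc i"])
  show "has_eps (PReps_stratum n) A C"
    using assms PRa_order[OF assms(3)] by (force simp: PReps_stratum_def)
qed

lemma U_stratum: "k < n \<Longrightarrow> Obj (PReps_stratum n) (U (Suc k))"
proof (induction k)
  case 0
  show ?case by (simp add: pr_theory.Obj_X)
next
  case (Suc k)
  then show ?case using stratum_exp(1)[OF _ pr_theory.Obj_X X_PRa U_order] by simp
qed

lemma U_stratum_eps: "Suc k < n \<Longrightarrow> has_eps (PReps_stratum n) (U (Suc k)) X"
  by (rule stratum_exp(2)[OF _ pr_theory.Obj_X X_PRa U_order]) (simp_all add: U_stratum)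

section \<open>The chain within the strata\<close>

lemma chain_retraction:
  "Suc k < n \<Longrightarrow> retraction_pair (PReps_stratum n) (U (Suc k)) (U (Suc (Suc k))) (emb (Suc k)) (ret (Suc k))"
proof (induction k)
  case 0
  have "has_order One 1" by (rule has_order.intros)
  then have "Obj (PReps_stratum n) (Exp X One)" "has_eps (PReps_stratum n) One X"
    using 0 stratum_exp[OF obj_One pr_theory.Obj_X X_PRa] by auto
  then show ?case
    using pr_theory.retraction_pair_emb_1[of "PReps_stratum n"] U_stratum[of 1 n] U_stratum_eps[of 0 n] 0
    by (simp add: numeral_2_eq_2)
next
  case (Suc k)
  then show ?case
    using pr_theory.retraction_pair_precomp[of "PReps_stratum n" "U (Suc k)" "U (Suc (Suc k))" "emb (Suc k)" "ret (Suc k)" X]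
      U_stratum[of "Suc k" n] U_stratum[of "Suc (Suc k)" n] U_stratum_eps[of k n] U_stratum_eps[of "Suc k" n]
    by simp
qed

lemma coretractive_Comp:
  "coretractive T A B f \<Longrightarrow> coretractive T B C g \<Longrightarrow> coretractive T A C (g \<cdot> f)"
  unfolding coretractive_def using pr_theory.retraction_pair_Comp by blast

lemma coretractive_extend:
  assumes "coretractive (PReps_stratum n) A (U k) f" "1 \<le> k" "k + j \<le> n"
  shows "coretractive (PReps_stratum n) A (U (k + j)) (extend k j f)"
  using assms(3)
proof (induction j)
  case 0
  then show ?case using assms by simp
next
  case (Suc j)
  then have "coretractive (PReps_stratum n) (U (k + j)) (U (k + Suc j)) (emb (k + j))"
    using chain_retraction[of "k + j - 1" n] assms(2) by (auto simp: coretractive_def)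
  then show ?case using Suc by (auto intro: coretractive_Comp)
qed

lemma coretractive_square:
  assumes "k < n"
  shows "\<exists>q. (k = 0 \<longrightarrow> q = code_pair) \<and>
    coretractive (PReps_stratum n) (Prod (U (Suc k)) (U (Suc k))) (U (Suc k)) q"
proof (cases k)
  case 0
  then show ?thesis using pr_theory.retraction_pair_code_pair by (auto simp: coretractive_def)
next
  case (Suc j)
  then show ?thesis
    using pr_theory.coretractive_power_square[OF pr_theory.retraction_pair_code_pair, of "PReps_stratum n" "U (Suc j)"]
      U_stratum[of k n] U_stratum_eps[of j n] assms by simp
qed

text \<open>
  The embedding is \<open>C^A \<rightarrow> C^U \<rightarrow> X^U\<close> for \<open>U = U (k + 1)\<close>. The intermediate object is available in
  the stratum because \<open>U\<close> and \<open>A\<close> have the same order.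
\<close>
lemma coretractive_Exp:
  assumes "coretractive (PReps_stratum n) C X b" "coretractive (PReps_stratum n) A (U (Suc k)) c"
    "Obj PRa C" "has_order A (Suc k)" "Suc k < n"
  shows "\<exists>f. coretractive (PReps_stratum n) (Exp C A) (U (Suc (Suc k))) f"
proof -
  let ?T = "PReps_stratum n" and ?U = "U (Suc k)"
  obtain b' c' where r: "retraction_pair ?T C X b b'" "retraction_pair ?T A ?U c c'"
    using assms by (auto simp: coretractive_def)
  note o = pr_theory.retraction_pairD(7)[OF r(1)] pr_theory.retraction_pairD(7)[OF r(2)]
  note e = stratum_exp[OF o(2) o(1) assms(3-5)]
  have u: "Obj ?T ?U" "Obj ?T (Exp X ?U)" "has_eps ?T ?U X"
    using assms(5) U_stratum[of k n] U_stratum[of "Suc k" n] U_stratum_eps[of k n] by simp_all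
  note cu = stratum_exp[OF u(1) o(1) assms(3) U_order assms(5)]
  have "retraction_pair ?T (Exp C A) (Exp C ?U) (precomp C ?U A c') (precomp C A ?U c)"
    using r(2) e(1) cu(1) e(2) cu(2) by (rule pr_theory.retraction_pair_precomp)
  moreover have "retraction_pair ?T (Exp C ?U) (Exp X ?U) (pow_map ?U C b) (pow_map ?U X b')"
    using r(1) cu(1) u(2) cu(2) u(3) by (rule pr_theory.retraction_pair_pow_map)
  ultimately have "coretractive ?T (Exp C A) (Exp X ?U) (pow_map ?U C b \<cdot> precomp C ?U A c')"
    unfolding coretractive_def by (blast intro: pr_theory.retraction_pair_Comp)
  then show ?thesis by auto
qed

lemma pointed_map: "pointed T A \<Longrightarrow> Map T A B f \<Longrightarrow> pointed T B"
  unfolding pointed_def using map_Comp by blast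

lemma pointed_Prod: "pointed T (Prod A B) \<longleftrightarrow> pointed T A \<and> pointed T B"
proof
  assume p: "pointed T (Prod A B)"
  then have "Obj T A" "Obj T B" using Map_Obj unfolding pointed_def by fastforce+
  then show "pointed T A \<and> pointed T B" using p pointed_map map_Fst map_Snd by blast
qed (auto simp: pointed_def intro: map_Pair)

lemma pointed_base:
  assumes "pointed T (Exp B A)" "pointed T A" "has_eps T A B" "Obj T (Exp B A)"
  shows "pointed T B"
proof -
  have "pointed T (Prod (Exp B A) A)" using assms by (simp add: pointed_Prod)
  moreover have "Map T (Prod (Exp B A) A) B (Eps A B)"
    using assms by (simp add: map_Eps Obj_Exp_iff)
  ultimately show ?thesis by (rule pointed_map)
qed

section \<open>Embedding the objects of a stratum\<close>

text \<open>
  The induction has to be on orders \<open>k\<close> below a fixed \<open>n\<close>, rather than on the strata: an extension of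
  low order may be cut out by a predicate that exists only in the stratum \<open>n\<close>, so that it is not an
  object of the stratum of its order. It is by size because the case \<open>(D^E)^B\<close> needs the embedding of
  \<open>E \<times> B\<close>, which is not a component of it.
\<close>
lemma stratum_embedding:
  assumes "Obj (PReps_stratum n) A" "pointed (PReps_stratum n) A"
    "pointed_exponents (PReps_stratum n) A" "has_order A k" "k \<le> n"
  shows "\<exists>f. (k = 1 \<longrightarrow> f = code_emb A) \<and> coretractive (PReps_stratum n) A (U k) f"
  using assms
proof (induction A arbitrary: k rule: measure_induct_rule[of size])
  case (less A)
  let ?T = "PReps_stratum n"
  note prems = less.prems
  show ?case
  proof (cases A)
    case One
    then have k: "k = 1" using prems(4) by (auto elim: order_base_elim)
    have "retraction_pair ?T One Nat Zero (Bang Nat)"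
      by (rule pr_theory.retraction_pair_One)
    then have "coretractive ?T One X (code_single \<cdot> Zero)"
      using pr_theory.retraction_pair_code_single coretractive_Comp unfolding coretractive_def by blast
    then show ?thesis using One k by auto
  next
    case Nat
    then have k: "k = 1" using prems(4) by (auto elim: order_base_elim)
    then show ?thesis
      using Nat pr_theory.retraction_pair_code_single unfolding coretractive_def by auto
  next
    case (Prod B C)
    then obtain i j where ij: "has_order B i" "has_order C j" "k = max i j"
      using prems(4) by (auto elim: order_Prod_elim)
    note pos = has_order_pos[OF ij(1)] has_order_pos[OF ij(2)]
    obtain f where f: "i = 1 \<longrightarrow> f = code_emb B" "coretractive ?T B (U i) f"
      using less.IH[of B i] prems Prod ij by (auto simp: pointed_Prod)
    obtain g where g: "j = 1 \<longrightarrow> g = code_emb C" "coretractive ?T C (U j) g"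
      using less.IH[of C j] prems Prod ij by (auto simp: pointed_Prod)
    have "1 \<le> k" using ij(3) pos by simp
    then obtain k' where k': "k = Suc k'" by (cases k) auto
    obtain q where q: "k = 1 \<longrightarrow> q = code_pair" "coretractive ?T (Prod (U k) (U k)) (U k) q"
      using coretractive_square[of k' n] k' prems(5) by auto
    let ?f = "extend i (k - i) f" and ?g = "extend j (k - j) g"
    have "coretractive ?T B (U k) ?f" "coretractive ?T C (U k) ?g"
      using coretractive_extend[OF f(2) pos(1), of "k - i"]
        coretractive_extend[OF g(2) pos(2), of "k - j"] ij prems(5) by auto
    then have "coretractive ?T A (U k) (q \<cdot> cross B C ?f ?g)"
      using q(2) coretractive_Comp pr_theory.retraction_pair_cross Prod
      unfolding coretractive_def by blast
    moreover have "q \<cdot> cross B C ?f ?g = code_emb A" if "k = 1"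
    proof -
      have "i = 1" "j = 1" using that ij pos by auto
      then show ?thesis using f g q that Prod by simp
    qed
    ultimately show ?thesis by blast
  next
    case (Sub B \<chi>)
    obtain p where p: "Map ?T One (Sub B \<chi>) p" using prems(2) Sub by (auto simp: pointed_def)
    then have r: "coretractive ?T A B (Incl B \<chi>)"
      using pr_theory.retraction_Sub[OF _ p] prems(1) Sub by (auto simp: coretractive_def)
    then have "pointed ?T B"
      using pointed_map prems(2) by (auto simp: coretractive_def retraction_pair_def)
    then obtain f where "k = 1 \<longrightarrow> f = code_emb B" "coretractive ?T B (U k) f"
      using less.IH[of B k] prems Sub by (auto dest: Obj_Sub_base elim: order_Sub_elim)
    then show ?thesis using coretractive_Comp[OF r] Sub by (intro exI[of _ "f \<cdot> Incl B \<chi>"]) auto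
  next
    case (Exp C B)
    have oBC: "Obj ?T B" "Obj ?T C" using prems(1) Exp by (simp_all add: Obj_Exp_iff)
    have pB: "pointed ?T B" "pointed_exponents ?T B" "pointed_exponents ?T C" using prems(3) Exp by simp_all
    consider i where "k = Suc i" "Obj PRa C" "has_order B i"
      | D E m i where "C = Exp D E" "k = Suc (max m i)" "Obj PRa D" "has_order E m" "has_order B i"
      using prems(4) unfolding Exp order_Exp_iff by blast
    then have "\<exists>f. coretractive ?T A (U k) f \<and> k \<noteq> 1"
    proof cases
      case (1 i)
      then obtain j where j: "i = Suc j" using has_order_pos by (cases i) force+
      have "pointed ?T C"
        using pointed_base stratum_exp[OF oBC 1(2)] prems 1 pB Exp by simp
      then obtain b where "coretractive ?T C X b"
        using less.IH[of C 1] PRa_order[OF 1(2)] prems 1(1) Exp oBC pB by auto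
      moreover obtain c where "coretractive ?T B (U i) c"
        using less.IH[of B i] 1 prems Exp oBC pB by auto
      ultimately show ?thesis
        using coretractive_Exp[of n C _ B j] 1 j prems(5) Exp by auto
    next
      case (2 D E m i)
      let ?P = "Prod E B"
      have oDE: "Obj ?T D" "Obj ?T E" using oBC(2) 2 by (simp_all add: Obj_Exp_iff)
      have pE: "pointed ?T E" "pointed_exponents ?T E" "pointed_exponents ?T D" using pB(3) 2 by simp_all
      have oP: "has_order ?P (max m i)" using 2 by (auto intro: has_order.intros)
      then obtain j where j: "max m i = Suc j" using has_order_pos[OF oP] by (cases "max m i") auto
      have mn: "max m i < n" using prems(5) unfolding 2(2) by (rule Suc_le_lessD)
      note e = stratum_exp[OF obj_Prod[OF oDE(2) oBC(1)] oDE(1) 2(3) oP mn]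
      \<comment> \<open>Evaluation on \<open>(D^E)^B\<close> may be missing in the stratum; that on \<open>D^(E \<times> B)\<close> is there.\<close>
      have "has_iso ?T B E D" using 2 mn by (auto simp: PReps_stratum_def)
      then have iso: "coretractive ?T A (Exp D ?P) (IsoTo B E D)"
        using pr_theory.retraction_pair_Iso[OF _ e(1)] prems(1) Exp 2 by (auto simp: coretractive_def)
      have "pointed ?T (Exp D ?P)"
        using pointed_map[OF prems(2)] iso by (auto simp: coretractive_def retraction_pair_def)
      moreover have pP: "pointed ?T ?P" using pB pE by (simp add: pointed_Prod)
      ultimately have "pointed ?T D" using pointed_base e by blast
      then obtain b where "coretractive ?T D X b"
        using less.IH[of D 1] PRa_order[OF 2(3)] mn Exp 2(1) oDE pE by auto
      moreover obtain c where "coretractive ?T ?P (U (max m i)) c"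
        using less.IH[of ?P "max m i"] oP mn pP pB pE oDE oBC Exp 2 by auto
      ultimately obtain f where "coretractive ?T (Exp D ?P) (U (Suc (max m i))) f"
        using coretractive_Exp[of n D b ?P j c] 2(3) oP j mn by auto
      then show ?thesis using coretractive_Comp[OF iso] 2 oP j by auto
    qed
    then show ?thesis by auto
  qed
qed

theorem mainTheorem4:
  shows "(\<forall>n\<ge>1. retraction_pair PReps (U n) (U (n + 1)) (emb n) (ret n)) \<and>
    (\<exists>\<eta> :: nat \<Rightarrow> obj \<Rightarrow> mor.
      (\<forall>A. Obj (PReps_stratum 1) A \<longrightarrow> \<eta> 1 A = code_emb A) \<and>
      (\<forall>n\<ge>1. \<forall>A. Obj (PReps_stratum n) A \<and> pointed (PReps_stratum n) A \<and>
            pointed_exponents (PReps_stratum n) A \<longrightarrow>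
          coretractive (PReps_stratum n) A (U n) (\<eta> n A) \<and>
          (\<forall>m>n. coretractive (PReps_stratum m) A (U m) (extend n (m - n) (\<eta> n A)))))"
proof (rule conjI)
  show "\<forall>n\<ge>1. retraction_pair PReps (U n) (U (n + 1)) (emb n) (ret n)"
  proof (intro allI impI)
    fix n :: nat assume "1 \<le> n"
    then obtain k where "n = Suc k" by (cases n) auto
    then show "retraction_pair PReps (U n) (U (n + 1)) (emb n) (ret n)"
      using retraction_pair_mono[OF stratum_le_PReps chain_retraction[of k "n + 1"]] by simp
  qed
next
  \<comment> \<open>The retractions entering the embeddings of exponentials depend on chosen points, hence a choice.\<close>
  define \<eta> where "\<eta> n A = (if n = 1 then code_emb A
    else SOME f. coretractive (PReps_stratum n) A (U n) f)" for n :: nat and A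
  have main: "coretractive (PReps_stratum n) A (U n) (\<eta> n A)"
    if n: "1 \<le> n" and A: "Obj (PReps_stratum n) A" "pointed (PReps_stratum n) A"
      "pointed_exponents (PReps_stratum n) A" for n A
  proof -
    obtain k where k: "k \<le> n" "has_order A k" using stratum_has_order[OF A(1) n] by blast
    obtain f where f: "k = 1 \<longrightarrow> f = code_emb A" "coretractive (PReps_stratum n) A (U k) f"
      using stratum_embedding[OF A k(2,1)] by blast
    show ?thesis
    proof (cases "n = 1")
      case True
      then show ?thesis using f k has_order_pos[OF k(2)] by (simp add: \<eta>_def)
    next
      case False
      have "coretractive (PReps_stratum n) A (U n) (extend k (n - k) f)"
        using coretractive_extend[OF f(2) has_order_pos[OF k(2)], of "n - k"] k by simp
      then show ?thesis using False by (auto simp: \<eta>_def intro: someI)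
    qed
  qed
  have "coretractive (PReps_stratum m) A (U m) (extend n (m - n) f)"
    if "coretractive (PReps_stratum n) A (U n) f" "1 \<le> n" "n < m" for n m A f
    using that coretractive_extend[of m A n f "m - n"] retraction_pair_mono[OF stratum_mono, of n m]
    by (fastforce simp: coretractive_def)
  moreover have "\<eta> 1 A = code_emb A" for A by (simp add: \<eta>_def)
  ultimately show "\<exists>\<eta> :: nat \<Rightarrow> obj \<Rightarrow> mor.
      (\<forall>A. Obj (PReps_stratum 1) A \<longrightarrow> \<eta> 1 A = code_emb A) \<and>
      (\<forall>n\<ge>1. \<forall>A. Obj (PReps_stratum n) A \<and> pointed (PReps_stratum n) A \<and>
            pointed_exponents (PReps_stratum n) A \<longrightarrow>
          coretractive (PReps_stratum n) A (U n) (\<eta> n A) \<and>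
          (\<forall>m>n. coretractive (PReps_stratum m) A (U m) (extend n (m - n) (\<eta> n A))))"
    using main by (intro exI[of _ \<eta>]) blast
qed

end
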